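(* Let $p$ be a prime, $n\ge 2$ an integer, $m=(m_1,\dots,m_n)$ a tuple of integers with $m_j\ge 1$, and $\beta\in\mathbb{C}$. Let $D^{\beta}_x$ be the Taibleson fractional operator $$(D^{\beta}_x\phi)(x)=F^{-1}\big[|\xi|_p^{\beta}\,F[\phi](\xi)\big](x),\qquad \phi\in\Phi(\mathbb{Q}_p^n).$$ Then for all $\gamma\in\mathbb{Z}$, $s\in J_{p;m}^n$, $a\in I_p^n$, the $n$-dimensional $p$-adic wavelet $$\Theta_{\gamma s a}^{(m)}(x)=p^{-n\gamma/2}\,\chi_p\big(s\cdot(p^{\gamma}x-a)\big)\,\Omega\big(|p^{\gamma}x-a|_p\big),\qquad x\in\mathbb{Q}_p^n,$$ is an eigenfunction of $D^{\beta}_x$: $$D^{\beta}_x\Theta_{\gamma s a}^{(m)}(x)=p^{\beta(\max\{m_1,\dots,m_n\}-\gamma)}\,\Theta_{\gamma s a}^{(m)}(x),\qquad x\in\mathbb{Q}_p^n.$$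
   Context: For $x\in\mathbb{Q}_p^n$, $|x|_p=\max_{1\le j\le n}|x_j|_p$. Haar measure $d^nx$ on $\mathbb{Q}_p^n$ is normalized so that $\mathbb{Z}_p^n$ has measure $1$. For $\xi,x\in\mathbb{Q}_p^n$, $\xi\cdot x=\sum_j\xi_jx_j$ and $\chi_p(\xi\cdot x)=e^{2\pi i\sum_{j=1}^n\{\xi_jx_j\}_p}$, where $\{y\}_p$ is the fractional part of $y\in\mathbb{Q}_p$: $\{y\}_p=0$ if $y\in\mathbb{Z}_p$, and $\{y\}_p=p^{\gamma}(y_0+y_1p+\cdots+y_{|\gamma|-1}p^{|\gamma|-1})$ if $y=p^{\gamma}(y_0+y_1p+\cdots)$ with $\gamma<0$, $0\le y_j\le p-1$, $y_0\neq0$. $\Omega(t)=1$ for $0\le t\le 1$ and $\Omega(t)=0$ for $t>1$. $I_p=\{p^{-k}(a_0+a_1p+\cdots+a_{k-1}p^{k-1}) : k\in\mathbb{N},\ a_j\in\{0,\dots,p-1\}\}$ (representatives of $\mathbb{Q}_p/\mathbb{Z}_p$; $\mathbb{N}$ is the set of positive integers) and $I_p^n=I_p\times\cdots\times I_p$. For an integer $k\ge1$, $J_{p;k}=\{p^{-k}(s_0+s_1p+\cdots+s_{k-1}p^{k-1}) : s_j\in\{0,\dots,p-1\},\ s_0\neq 0\}$ and $J_{p;m}^n=J_{p;m_1}\times\cdots\times J_{p;m_n}$. $\mathcal{D}(\mathbb{Q}_p^n)$ is the space of locally constant, compactly supported functions $\mathbb{Q}_p^n\to\mathbb{C}$. The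 Fourier transform on $\mathcal{D}(\mathbb{Q}_p^n)$ is $F[\varphi](\xi)=\int_{\mathbb{Q}_p^n}\chi_p(\xi\cdot x)\varphi(x)\,d^nx$, with inverse $F^{-1}[\psi](x)=\int_{\mathbb{Q}_p^n}\chi_p(-x\cdot\xi)\psi(\xi)\,d^n\xi$. Let $\Psi(\mathbb{Q}_p^n)=\{\psi\in\mathcal{D}(\mathbb{Q}_p^n):\psi(0)=0\}$. The $p$-adic Lizorkin space of test functions is $\Phi(\mathbb{Q}_p^n)=\{F[\psi]:\psi\in\Psi(\mathbb{Q}_p^n)\}$, equivalently the set of $\phi\in\mathcal{D}(\mathbb{Q}_p^n)$ with $\int_{\mathbb{Q}_p^n}\phi\,d^nx=0$. For $\phi\in\Phi(\mathbb{Q}_p^n)$, $F[\phi]$ vanishes in a neighbourhood of $0$, and $|\xi|_p^{\beta}F[\phi](\xi)$ is taken to be $0$ at $\xi=0$; for real $t>0$, $t^{\beta}=e^{\beta\ln t}$. The wavelets $\Theta_{\gamma s a}^{(m)}$ belong to $\Phi(\mathbb{Q}_p^n)$. *)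

theory Defs
  imports "HOL-Analysis.Analysis" "Berlekamp_Zassenhaus.Finite_Field"
begin

section \<open>The field of \<open>p\<close>-adic numbers\<close>

text \<open>
  The prime is carried by a type variable of class \<open>prime_card\<close>: \<open>p = CARD('p)\<close>. As usual,
  \<open>\<rat>\<^sub>p\<close> is the completion of \<open>\<rat>\<close> with respect to the \<open>p\<close>-adic absolute value.
\<close>

subsection \<open>The \<open>p\<close>-adic absolute value of a rational number\<close>

definition rat_padic_abs :: "nat \<Rightarrow> rat \<Rightarrow> real" where
  "rat_padic_abs p q =
     (if q = 0 then 0
      else real p powi (int (multiplicity (int p) (snd (quotient_of q)))
                        - int (multiplicity (int p) (fst (quotient_of q)))))"

lemma rat_padic_abs_0 [simp]: "rat_padic_abs p 0 = 0"
  by (simp add: rat_padic_abs_def)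

lemma rat_padic_abs_Fract:
  assumes "prime p" "a \<noteq> 0" "b \<noteq> 0"
  shows "rat_padic_abs p (Rat.Fract a b) =
           real p powi (int (multiplicity (int p) b) - int (multiplicity (int p) a))"
proof -
  obtain c d where cd: "quotient_of (Rat.Fract a b) = (c, d)"
    by (cases "quotient_of (Rat.Fract a b)")
  have d: "d > 0" by (rule quotient_of_denom_pos[OF cd])
  have eq: "Rat.Fract a b = Rat.Fract c d"
    using quotient_of_div[OF cd] by (simp add: Fract_of_int_quotient)
  have ad: "a * d = c * b"
    using eq assms d by (simp add: eq_rat)
  have c: "c \<noteq> 0" using ad assms d by auto
  have pe: "prime_elem (int p)" using assms by simp
  have "multiplicity (int p) a + multiplicity (int p) d = multiplicity (int p) c + multiplicity (int p) b"
    using ad prime_elem_multiplicity_mult_distrib[OF pe] assms c d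
    by (metis less_irrefl)
  moreover have "Rat.Fract a b \<noteq> 0" using assms by (simp add: Zero_rat_def eq_rat)
  ultimately show ?thesis
    by (simp add: rat_padic_abs_def cd) (rule arg_cong[where f = "\<lambda>x. real p powi x"], linarith)
qed

lemma rat_padic_abs_nonneg [simp]: "rat_padic_abs p q \<ge> 0"
  by (simp add: rat_padic_abs_def)

lemma rat_padic_abs_eq_0_iff:
  assumes "prime p" shows "rat_padic_abs p q = 0 \<longleftrightarrow> q = 0"
  using prime_gt_0_nat[OF assms] by (auto simp: rat_padic_abs_def)

lemma rat_padic_abs_mult:
  assumes "prime p"
  shows "rat_padic_abs p (x * y) = rat_padic_abs p x * rat_padic_abs p y"
proof (cases "x = 0 \<or> y = 0")
  case True
  then show ?thesis by auto
next
  case False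
  obtain a b where x: "x = Rat.Fract a b" "b > 0" by (cases x) auto
  obtain c d where y: "y = Rat.Fract c d" "d > 0" by (cases y) auto
  have ac: "a \<noteq> 0" "c \<noteq> 0" using False x y by (auto simp: rat_number_collapse)
  have pe: "prime_elem (int p)" using assms by simp
  have p0: "real p \<noteq> 0" using prime_gt_0_nat[OF assms] by simp
  have "rat_padic_abs p (x * y) =
      real p powi (int (multiplicity (int p) (b * d)) - int (multiplicity (int p) (a * c)))"
    using x y ac assms by (simp add: rat_padic_abs_Fract)
  also have "\<dots> = real p powi ((int (multiplicity (int p) b) - int (multiplicity (int p) a)) +
      (int (multiplicity (int p) d) - int (multiplicity (int p) c)))"
    using x y ac prime_elem_multiplicity_mult_distrib[OF pe] by (simp add: algebra_simps)
  also have "\<dots> = rat_padic_abs p x * rat_padic_abs p y"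
    using x y ac assms p0 by (simp add: rat_padic_abs_Fract power_int_add)
  finally show ?thesis .
qed

lemma rat_padic_abs_1 [simp]: "rat_padic_abs p 1 = 1"
  by (simp add: rat_padic_abs_def)

lemma rat_padic_abs_minus [simp]: "rat_padic_abs p (- x) = rat_padic_abs p x"
proof -
  have "multiplicity (int p) (- a) = multiplicity (int p) a" for a
    using multiplicity_times_unit_right[of "- 1" "int p" a] by simp
  then show ?thesis
    by (simp add: rat_padic_abs_def rat_uminus_code split: prod.splits)
qed

lemma rat_padic_abs_diff_commute: "rat_padic_abs p (x - y) = rat_padic_abs p (y - x)"
  by (metis minus_diff_eq rat_padic_abs_minus)

lemma rat_padic_abs_inverse:
  assumes "prime p"
  shows "rat_padic_abs p (inverse x) = inverse (rat_padic_abs p x)"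
proof (cases "x = 0")
  case False
  then have "rat_padic_abs p x * rat_padic_abs p (inverse x) = 1"
    using rat_padic_abs_mult[OF assms, of x "inverse x"] by simp
  then show ?thesis by (metis inverse_unique)
qed simp

lemma rat_padic_abs_ultrametric:
  assumes "prime p"
  shows "rat_padic_abs p (x + y) \<le> max (rat_padic_abs p x) (rat_padic_abs p y)"
proof (cases "x = 0 \<or> y = 0 \<or> x + y = 0")
  case True
  then show ?thesis by (auto simp: max_def)
next
  case False
  obtain a b where x: "x = Rat.Fract a b" "b > 0" by (cases x) auto
  obtain c d where y: "y = Rat.Fract c d" "d > 0" by (cases y) auto
  define A C B where "A = a * d" and "C = c * b" and "B = b * d"
  have B: "B \<noteq> 0" using x y by (simp add: B_def)
  have xy: "x = Rat.Fract A B" "y = Rat.Fract C B" "x + y = Rat.Fract (A + C) B"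
    using x y by (auto simp: A_def B_def C_def eq_rat)
  have nz: "A \<noteq> 0" "C \<noteq> 0" "A + C \<noteq> 0"
    using False xy by (auto simp: rat_number_collapse)
  let ?v = "multiplicity (int p)"
  let ?m = "min (?v A) (?v C)"
  have p1: "real p \<ge> 1" using prime_gt_0_nat[OF assms] by simp
  have "int p ^ ?m dvd A" "int p ^ ?m dvd C" by (simp_all add: multiplicity_dvd')
  then have "int p ^ ?m dvd A + C" by simp
  then have "?m \<le> ?v (A + C)"
    using nz prime_gt_1_nat[OF assms] by (intro multiplicity_geI) auto
  then have "real p powi (int (?v B) - int (?v (A + C))) \<le> real p powi (int (?v B) - int ?m)"
    using p1 by (intro power_int_increasing) auto
  also have "\<dots> \<le> max (real p powi (int (?v B) - int (?v A))) (real p powi (int (?v B) - int (?v C)))"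
    by (simp add: min_def)
  finally show ?thesis
    unfolding xy(3) unfolding xy(1,2)
    by (simp only: rat_padic_abs_Fract[OF assms nz(1) B] rat_padic_abs_Fract[OF assms nz(2) B]
        rat_padic_abs_Fract[OF assms nz(3) B])
qed

lemma rat_padic_abs_triangle:
  assumes "prime p"
  shows "rat_padic_abs p (x + y) \<le> rat_padic_abs p x + rat_padic_abs p y"
  using rat_padic_abs_ultrametric[OF assms, of x y] rat_padic_abs_nonneg[of p x]
    rat_padic_abs_nonneg[of p y] by linarith

lemma rat_padic_abs_diff_triangle:
  assumes "prime p"
  shows "rat_padic_abs p (x - z) \<le> rat_padic_abs p (x - y) + rat_padic_abs p (y - z)"
  using rat_padic_abs_triangle[OF assms, of "x - y" "y - z"] by simp

lemma rat_padic_abs_abs_diff: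
  assumes "prime p"
  shows "\<bar>rat_padic_abs p x - rat_padic_abs p y\<bar> \<le> rat_padic_abs p (x - y)"
  using rat_padic_abs_triangle[OF assms, of "x - y" y] rat_padic_abs_triangle[OF assms, of "y - x" x]
    rat_padic_abs_diff_commute[of p x y] by simp

subsection \<open>The completion\<close>

definition padic_vanishes :: "nat \<Rightarrow> (nat \<Rightarrow> rat) \<Rightarrow> bool" where
  "padic_vanishes p X \<longleftrightarrow> (\<lambda>n. rat_padic_abs p (X n)) \<longlonglongrightarrow> 0"

definition padic_Cauchy :: "nat \<Rightarrow> (nat \<Rightarrow> rat) \<Rightarrow> bool" where
  "padic_Cauchy p X \<longleftrightarrow>
     (\<forall>e>0. \<exists>N. \<forall>m\<ge>N. \<forall>n\<ge>N. rat_padic_abs p (X m - X n) < e)"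

lemma padic_Cauchy_const [simp]: "padic_Cauchy p (\<lambda>n. c)"
  by (simp add: padic_Cauchy_def)

lemma padic_vanishes_0 [simp]: "padic_vanishes p (\<lambda>n. 0)"
  by (simp add: padic_vanishes_def)

lemma padic_vanishes_squeeze:
  assumes "\<And>n. rat_padic_abs p (X n) \<le> f n" "f \<longlonglongrightarrow> 0"
  shows "padic_vanishes p X"
  unfolding padic_vanishes_def
  by (rule tendsto_sandwich[OF _ _ tendsto_const assms(2)]) (use assms(1) in auto)

lemma padic_vanishes_add:
  assumes "prime p" "padic_vanishes p X" "padic_vanishes p Y"
  shows "padic_vanishes p (\<lambda>n. X n + Y n)"
  using rat_padic_abs_triangle[OF assms(1)] tendsto_add[of _ 0 sequentially _ 0] assms(2,3)
  by (intro padic_vanishes_squeeze[where f = "\<lambda>n. rat_padic_abs p (X n) + rat_padic_abs p (Y n)"])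
     (force simp: padic_vanishes_def)+

lemma padic_vanishes_minus:
  "padic_vanishes p X \<Longrightarrow> padic_vanishes p (\<lambda>n. - X n)"
  by (simp add: padic_vanishes_def)

lemma padic_vanishes_mult_bounded:
  assumes "prime p" "\<And>n. rat_padic_abs p (X n) \<le> B" "padic_vanishes p Y"
  shows "padic_vanishes p (\<lambda>n. X n * Y n)"
proof (rule padic_vanishes_squeeze)
  show "rat_padic_abs p (X n * Y n) \<le> B * rat_padic_abs p (Y n)" for n
    using assms(2)[of n] by (simp add: rat_padic_abs_mult[OF assms(1)] mult_right_mono)
  show "(\<lambda>n. B * rat_padic_abs p (Y n)) \<longlonglongrightarrow> 0"
    using tendsto_mult_left[OF assms(3)[unfolded padic_vanishes_def], of B] by simp
qed

lemma padic_Cauchy_abs_convergent: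
  assumes "prime p" "padic_Cauchy p X"
  shows "convergent (\<lambda>n. rat_padic_abs p (X n))"
proof (rule real_Cauchy_convergent, rule metric_CauchyI)
  fix e :: real assume "e > 0"
  then obtain N where "\<forall>m\<ge>N. \<forall>n\<ge>N. rat_padic_abs p (X m - X n) < e"
    using assms(2) by (auto simp: padic_Cauchy_def)
  then show "\<exists>M. \<forall>m\<ge>M. \<forall>n\<ge>M. dist (rat_padic_abs p (X m)) (rat_padic_abs p (X n)) < e"
    unfolding dist_real_def by (meson rat_padic_abs_abs_diff[OF assms(1)] le_less_trans)
qed

lemma padic_Cauchy_bounded:
  assumes "prime p" "padic_Cauchy p X"
  obtains B where "B > 0" "\<And>n. rat_padic_abs p (X n) \<le> B"
proof -
  have "Bseq (\<lambda>n. rat_padic_abs p (X n))"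
    using padic_Cauchy_abs_convergent[OF assms] by (rule convergent_imp_Bseq)
  then show ?thesis using that by (elim BseqE) auto
qed

lemma padic_Cauchy_add:
  assumes "prime p" "padic_Cauchy p X" "padic_Cauchy p Y"
  shows "padic_Cauchy p (\<lambda>n. X n + Y n)"
  unfolding padic_Cauchy_def
proof (intro allI impI)
  fix e :: real assume "e > 0"
  then have "e / 2 > 0" by simp
  then obtain M N where
    M: "\<forall>m\<ge>M. \<forall>n\<ge>M. rat_padic_abs p (X m - X n) < e / 2" and
    N: "\<forall>m\<ge>N. \<forall>n\<ge>N. rat_padic_abs p (Y m - Y n) < e / 2"
    using assms(2,3) unfolding padic_Cauchy_def by meson
  show "\<exists>N. \<forall>m\<ge>N. \<forall>n\<ge>N. rat_padic_abs p (X m + Y m - (X n + Y n)) < e"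
  proof (intro exI allI impI)
    fix m n assume mn: "max M N \<le> m" "max M N \<le> n"
    have "rat_padic_abs p (X m + Y m - (X n + Y n))
        \<le> rat_padic_abs p (X m - X n) + rat_padic_abs p (Y m - Y n)"
      using rat_padic_abs_triangle[OF assms(1), of "X m - X n" "Y m - Y n"]
      by (simp add: algebra_simps)
    also have "\<dots> < e / 2 + e / 2"
      using M N mn by (intro add_strict_mono) auto
    finally show "rat_padic_abs p (X m + Y m - (X n + Y n)) < e" by simp
  qed
qed

lemma padic_Cauchy_minus:
  assumes "padic_Cauchy p X"
  shows "padic_Cauchy p (\<lambda>n. - X n)"
  using assms by (simp add: padic_Cauchy_def rat_padic_abs_diff_commute)

lemma padic_Cauchy_mult:
  assumes "prime p" "padic_Cauchy p X" "padic_Cauchy p Y"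
  shows "padic_Cauchy p (\<lambda>n. X n * Y n)"
  unfolding padic_Cauchy_def
proof (intro allI impI)
  fix e :: real assume e: "e > 0"
  obtain A where A: "A > 0" "\<And>n. rat_padic_abs p (X n) \<le> A"
    using padic_Cauchy_bounded[OF assms(1,2)] by blast
  obtain B where B: "B > 0" "\<And>n. rat_padic_abs p (Y n) \<le> B"
    using padic_Cauchy_bounded[OF assms(1,3)] by blast
  have "e / (2 * B) > 0" "e / (2 * A) > 0" using e A B by auto
  then obtain M N where
    M: "\<forall>m\<ge>M. \<forall>n\<ge>M. rat_padic_abs p (X m - X n) < e / (2 * B)" and
    N: "\<forall>m\<ge>N. \<forall>n\<ge>N. rat_padic_abs p (Y m - Y n) < e / (2 * A)"
    using assms(2,3) unfolding padic_Cauchy_def by meson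
  show "\<exists>N. \<forall>m\<ge>N. \<forall>n\<ge>N. rat_padic_abs p (X m * Y m - X n * Y n) < e"
  proof (intro exI allI impI)
    fix m n assume mn: "max M N \<le> m" "max M N \<le> n"
    have "rat_padic_abs p (X m * Y m - X n * Y n)
        = rat_padic_abs p (X m * (Y m - Y n) + (X m - X n) * Y n)"
      by (simp add: algebra_simps)
    also have "\<dots> \<le> rat_padic_abs p (X m) * rat_padic_abs p (Y m - Y n)
        + rat_padic_abs p (X m - X n) * rat_padic_abs p (Y n)"
      using rat_padic_abs_triangle[OF assms(1)] by (simp flip: rat_padic_abs_mult[OF assms(1)])
    also have "\<dots> \<le> A * rat_padic_abs p (Y m - Y n) + rat_padic_abs p (X m - X n) * B"
      using A B by (intro add_mono mult_right_mono mult_left_mono) auto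
    also have "\<dots> < A * (e / (2 * A)) + (e / (2 * B)) * B"
      using A B M N mn by (intro add_strict_mono mult_strict_left_mono mult_strict_right_mono) auto
    also have "\<dots> = e" using A B by (simp add: field_simps)
    finally show "rat_padic_abs p (X m * Y m - X n * Y n) < e" .
  qed
qed

lemma padic_Cauchy_not_vanishes:
  assumes "prime p" "padic_Cauchy p X" "\<not> padic_vanishes p X"
  obtains b N where "b > 0" "\<And>n. n \<ge> N \<Longrightarrow> b < rat_padic_abs p (X n)"
proof -
  obtain L where L: "(\<lambda>n. rat_padic_abs p (X n)) \<longlonglongrightarrow> L"
    using padic_Cauchy_abs_convergent[OF assms(1,2)] by (auto simp: convergent_def)
  have "L \<ge> 0" by (rule LIMSEQ_le_const[OF L]) auto
  moreover have "L \<noteq> 0" using L assms(3) by (auto simp: padic_vanishes_def)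
  ultimately have "L / 2 < L" "L / 2 > 0" by auto
  moreover from this obtain N where "\<And>n. n \<ge> N \<Longrightarrow> L / 2 < rat_padic_abs p (X n)"
    using order_tendstoD(1)[OF L, of "L / 2"] by (auto simp: eventually_sequentially)
  ultimately show ?thesis using that by blast
qed

lemma padic_Cauchy_inverse:
  assumes "prime p" "padic_Cauchy p X" "\<not> padic_vanishes p X"
  shows "padic_Cauchy p (\<lambda>n. inverse (X n))"
  unfolding padic_Cauchy_def
proof (intro allI impI)
  fix e :: real assume e: "e > 0"
  obtain b M where b: "b > 0" "\<And>n. n \<ge> M \<Longrightarrow> b < rat_padic_abs p (X n)"
    using padic_Cauchy_not_vanishes[OF assms] by blast
  have "b * e * b > 0" using b e by simp
  then obtain N where N: "\<forall>m\<ge>N. \<forall>n\<ge>N. rat_padic_abs p (X m - X n) < b * e * b"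
    using assms(2) unfolding padic_Cauchy_def by meson
  show "\<exists>N. \<forall>m\<ge>N. \<forall>n\<ge>N. rat_padic_abs p (inverse (X m) - inverse (X n)) < e"
  proof (intro exI allI impI)
    fix m n assume mn: "max M N \<le> m" "max M N \<le> n"
    have bmn: "b < rat_padic_abs p (X m)" "b < rat_padic_abs p (X n)" using b mn by auto
    then have nz: "X m \<noteq> 0" "X n \<noteq> 0" using b by auto
    have "rat_padic_abs p (inverse (X m) - inverse (X n))
        = inverse (rat_padic_abs p (X m)) * rat_padic_abs p (X m - X n) * inverse (rat_padic_abs p (X n))"
      using nz by (simp add: inverse_diff_inverse rat_padic_abs_mult[OF assms(1)]
          rat_padic_abs_inverse[OF assms(1)])
    also have "\<dots> < inverse b * (b * e * b) * inverse b"
      using bmn b N mn e by (intro mult_strict_mono' less_imp_inverse_less) auto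
    also have "\<dots> = e" using b by simp
    finally show "rat_padic_abs p (inverse (X m) - inverse (X n)) < e" .
  qed
qed

lemma padic_vanishes_diff_inverse:
  assumes "prime p" "padic_Cauchy p X" "\<not> padic_vanishes p X"
    and "padic_Cauchy p Y" "\<not> padic_vanishes p Y" "padic_vanishes p (\<lambda>n. X n - Y n)"
  shows "padic_vanishes p (\<lambda>n. inverse (X n) - inverse (Y n))"
proof -
  obtain a M where a: "a > 0" "\<And>n. n \<ge> M \<Longrightarrow> a < rat_padic_abs p (X n)"
    using padic_Cauchy_not_vanishes[OF assms(1-3)] by blast
  obtain b N where b: "b > 0" "\<And>n. n \<ge> N \<Longrightarrow> b < rat_padic_abs p (Y n)"
    using padic_Cauchy_not_vanishes[OF assms(1,4,5)] by blast
  have "rat_padic_abs p (inverse (X n) - inverse (Y n))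
      \<le> inverse a * rat_padic_abs p (X n - Y n) * inverse b" if n: "n \<ge> max M N" for n
  proof -
    have bmn: "a < rat_padic_abs p (X n)" "b < rat_padic_abs p (Y n)" using a b n by auto
    then have nz: "X n \<noteq> 0" "Y n \<noteq> 0" using a b by auto
    have "rat_padic_abs p (inverse (X n) - inverse (Y n))
        = inverse (rat_padic_abs p (X n)) * rat_padic_abs p (X n - Y n) * inverse (rat_padic_abs p (Y n))"
      using nz by (simp add: inverse_diff_inverse rat_padic_abs_mult[OF assms(1)]
          rat_padic_abs_inverse[OF assms(1)])
    also have "\<dots> \<le> inverse a * rat_padic_abs p (X n - Y n) * inverse b"
      using bmn a b by (intro mult_mono le_imp_inverse_le) auto
    finally show ?thesis .
  qed
  then have le: "\<forall>\<^sub>F n in sequentially. rat_padic_abs p (inverse (X n) - inverse (Y n))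
      \<le> inverse a * rat_padic_abs p (X n - Y n) * inverse b"
    unfolding eventually_sequentially by blast
  have lim: "(\<lambda>n. inverse a * rat_padic_abs p (X n - Y n) * inverse b) \<longlonglongrightarrow> inverse a * 0 * inverse b"
    using assms(6) unfolding padic_vanishes_def by (rule tendsto_mult[OF tendsto_mult_left tendsto_const])
  have "(\<lambda>n. rat_padic_abs p (inverse (X n) - inverse (Y n))) \<longlonglongrightarrow> 0"
    by (rule tendsto_sandwich[OF _ le tendsto_const]) (use lim in auto)
  then show ?thesis
    by (simp only: padic_vanishes_def)
qed

lemma padic_vanishes_diff_iff:
  assumes "prime p" "padic_vanishes p (\<lambda>n. X n - Y n)"
  shows "padic_vanishes p X \<longleftrightarrow> padic_vanishes p Y"
proof
  assume "padic_vanishes p X"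
  from padic_vanishes_add[OF assms(1) this padic_vanishes_minus[OF assms(2)]]
  show "padic_vanishes p Y" by simp
next
  assume "padic_vanishes p Y"
  from padic_vanishes_add[OF assms this] show "padic_vanishes p X" by simp
qed

text \<open>The field \<open>\<rat>\<^sub>p\<close> is the ring of Cauchy sequences modulo the null sequences.\<close>

typedef (overloaded) ('p::prime_card) padic_seq = "{X. padic_Cauchy CARD('p) X}"
  by (rule exI[of _ "\<lambda>n. 0"]) simp

setup_lifting type_definition_padic_seq

instantiation padic_seq :: (prime_card) comm_ring_1
begin

lift_definition zero_padic_seq :: "'a padic_seq" is "\<lambda>n. 0" by simp
lift_definition one_padic_seq :: "'a padic_seq" is "\<lambda>n. 1" by simp
lift_definition plus_padic_seq :: "'a padic_seq \<Rightarrow> 'a padic_seq \<Rightarrow> 'a padic_seq"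
  is "\<lambda>X Y n. X n + Y n" by (rule padic_Cauchy_add[OF prime_card])
lift_definition uminus_padic_seq :: "'a padic_seq \<Rightarrow> 'a padic_seq"
  is "\<lambda>X n. - X n" by (rule padic_Cauchy_minus)
lift_definition minus_padic_seq :: "'a padic_seq \<Rightarrow> 'a padic_seq \<Rightarrow> 'a padic_seq"
  is "\<lambda>X Y n. X n - Y n"
  using padic_Cauchy_add[OF prime_card _ padic_Cauchy_minus] by fastforce
lift_definition times_padic_seq :: "'a padic_seq \<Rightarrow> 'a padic_seq \<Rightarrow> 'a padic_seq"
  is "\<lambda>X Y n. X n * Y n" by (rule padic_Cauchy_mult[OF prime_card])

instance
  by standard (transfer; simp add: algebra_simps fun_eq_iff)+

end

lift_definition padic_null :: "'p::prime_card padic_seq \<Rightarrow> bool"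
  is "padic_vanishes CARD('p)" .

lift_definition inverse_padic_seq :: "'p::prime_card padic_seq \<Rightarrow> 'p padic_seq"
  is "\<lambda>X n. if padic_vanishes CARD('p) X then 0 else inverse (X n)"
  subgoal for X by (cases "padic_vanishes CARD('p) X") (auto intro: padic_Cauchy_inverse[OF prime_card])
  done

lift_definition padic_seq_abs :: "'p::prime_card padic_seq \<Rightarrow> real"
  is "\<lambda>X. lim (\<lambda>n. rat_padic_abs CARD('p) (X n))" .

lemma padic_null_0 [simp]: "padic_null 0"
  by transfer simp

lemma padic_null_add: "padic_null X \<Longrightarrow> padic_null Y \<Longrightarrow> padic_null (X + Y)"
  by transfer (rule padic_vanishes_add[OF prime_card])

lemma padic_null_minus: "padic_null X \<Longrightarrow> padic_null (- X)"
  by transfer (rule padic_vanishes_minus)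

lemma padic_null_mult: "padic_null Y \<Longrightarrow> padic_null (X * Y)"
proof transfer
  fix X Y :: "nat \<Rightarrow> rat"
  assume X: "padic_Cauchy CARD('a) X" and Y: "padic_vanishes CARD('a) Y"
  obtain B where "B > 0" "\<And>n. rat_padic_abs CARD('a) (X n) \<le> B"
    using padic_Cauchy_bounded[OF prime_card X] by blast
  then show "padic_vanishes CARD('a) (\<lambda>n. X n * Y n)"
    using padic_vanishes_mult_bounded[OF prime_card _ Y] by blast
qed

lemma padic_null_diff_iff: "padic_null (X - Y) \<Longrightarrow> padic_null X \<longleftrightarrow> padic_null Y"
  by transfer (rule padic_vanishes_diff_iff[OF prime_card])

lemma padic_null_diff_inverse:
  assumes "padic_null (X - Y)"
  shows "padic_null (inverse_padic_seq X - inverse_padic_seq Y)"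
  using assms padic_null_diff_iff[OF assms]
  by transfer (auto intro: padic_vanishes_diff_inverse[OF prime_card])

lemma padic_null_inverse_mult:
  "\<not> padic_null X \<Longrightarrow> padic_null (inverse_padic_seq X * X - 1)"
proof transfer
  fix X :: "nat \<Rightarrow> rat"
  assume X: "padic_Cauchy CARD('a) X" "\<not> padic_vanishes CARD('a) X"
  obtain b N where "b > 0" "\<And>n. n \<ge> N \<Longrightarrow> b < rat_padic_abs CARD('a) (X n)"
    using padic_Cauchy_not_vanishes[OF prime_card X] by blast
  then have "X n \<noteq> 0" if "n \<ge> N" for n using that by fastforce
  then have "\<forall>n\<ge>N. rat_padic_abs CARD('a) (inverse (X n) * X n - 1) = 0" by simp
  then have "\<forall>\<^sub>F n in sequentially. rat_padic_abs CARD('a) (inverse (X n) * X n - 1) = 0"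
    unfolding eventually_sequentially by blast
  then show "padic_vanishes CARD('a)
      (\<lambda>n. (if padic_vanishes CARD('a) X then 0 else inverse (X n)) * X n - 1)"
    using X(2) by (simp add: padic_vanishes_def tendsto_eventually)
qed

definition padic_rel :: "'p::prime_card padic_seq \<Rightarrow> 'p padic_seq \<Rightarrow> bool" where
  "padic_rel X Y \<longleftrightarrow> padic_null (X - Y)"

lemma equivp_padic_rel: "equivp padic_rel"
proof (rule equivpI)
  show "reflp padic_rel" by (simp add: reflp_def padic_rel_def)
  show "symp padic_rel"
    unfolding symp_def padic_rel_def using padic_null_minus by fastforce
  show "transp padic_rel"
    unfolding transp_def padic_rel_def using padic_null_add by fastforce
qed

quotient_type (overloaded) 'p padic = "'p::prime_card padic_seq" / padic_rel
  by (rule equivp_padic_rel)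

instantiation padic :: (prime_card) field
begin

lift_definition zero_padic :: "'a padic" is 0 .
lift_definition one_padic :: "'a padic" is 1 .
lift_definition plus_padic :: "'a padic \<Rightarrow> 'a padic \<Rightarrow> 'a padic" is "(+)"
  unfolding padic_rel_def add_diff_add by (rule padic_null_add)
lift_definition uminus_padic :: "'a padic \<Rightarrow> 'a padic" is uminus
  unfolding padic_rel_def minus_diff_minus by (rule padic_null_minus)
lift_definition minus_padic :: "'a padic \<Rightarrow> 'a padic \<Rightarrow> 'a padic" is "(-)"
  subgoal for X X' Y Y'
    using padic_null_add[of "X - X'" "- (Y - Y')"] padic_null_minus[of "Y - Y'"]
    by (simp add: padic_rel_def algebra_simps)
  done
lift_definition times_padic :: "'a padic \<Rightarrow> 'a padic \<Rightarrow> 'a padic" is "(*)"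
  subgoal for X X' Y Y'
    using padic_null_add[OF padic_null_mult[of "Y - Y'" X] padic_null_mult[of "X - X'" Y']]
    by (simp add: padic_rel_def algebra_simps)
  done
lift_definition inverse_padic :: "'a padic \<Rightarrow> 'a padic" is inverse_padic_seq
  unfolding padic_rel_def by (rule padic_null_diff_inverse)

definition divide_padic :: "'a padic \<Rightarrow> 'a padic \<Rightarrow> 'a padic" where
  "divide_padic x y = x * inverse y"

instance
proof
  fix a b c :: "'a padic"
  show "(a * b) * c = a * (b * c)"
    by transfer (simp add: ac_simps padic_rel_def)
  show "a * b = b * a"
    by transfer (simp add: ac_simps padic_rel_def)
  show "1 * a = a"
    by transfer (simp add: padic_rel_def)
  show "(a + b) + c = a + (b + c)"
    by transfer (simp add: ac_simps padic_rel_def)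
  show "a + b = b + a"
    by transfer (simp add: ac_simps padic_rel_def)
  show "0 + a = a"
    by transfer (simp add: padic_rel_def)
  show "- a + a = 0"
    by transfer (simp add: padic_rel_def)
  show "a - b = a + - b"
    by transfer (simp add: padic_rel_def)
  show "(a + b) * c = a * c + b * c"
    by transfer (simp add: distrib_right padic_rel_def)
  have "\<not> padic_null (0 - 1 :: 'a padic_seq)"
    by transfer (simp add: padic_vanishes_def LIMSEQ_const_iff)
  then show "(0::'a padic) \<noteq> 1"
    by transfer (simp add: padic_rel_def)
  show "a \<noteq> 0 \<Longrightarrow> inverse a * a = 1"
    by transfer (simp add: padic_rel_def padic_null_inverse_mult)
  show "a div b = a * inverse b"
    by (rule divide_padic_def)
  have "inverse_padic_seq 0 = (0 :: 'a padic_seq)"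
    by transfer simp
  then show "inverse (0::'a padic) = 0"
    by transfer (simp add: padic_rel_def)
qed

end

subsection \<open>The absolute value and the topology of \<open>\<rat>\<^sub>p\<close>\<close>

lemma padic_seq_abs_LIMSEQ:
  "(\<lambda>n. rat_padic_abs CARD('p) (Rep_padic_seq X n)) \<longlonglongrightarrow> padic_seq_abs (X :: 'p::prime_card padic_seq)"
  using padic_Cauchy_abs_convergent[OF prime_card] Rep_padic_seq[of X]
  by (simp add: padic_seq_abs.rep_eq convergent_LIMSEQ_iff)

lemma padic_seq_abs_eq_0_iff: "padic_seq_abs X = 0 \<longleftrightarrow> padic_null X"
  using padic_seq_abs_LIMSEQ[of X]
  by (auto simp: padic_null.rep_eq padic_vanishes_def dest: LIMSEQ_unique)

lemma padic_seq_abs_nonneg: "padic_seq_abs X \<ge> 0"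
  by (rule LIMSEQ_le_const[OF padic_seq_abs_LIMSEQ]) auto

lemma padic_seq_abs_ultrametric:
  "padic_seq_abs (X + Y) \<le> max (padic_seq_abs X) (padic_seq_abs Y)"
  by (rule LIMSEQ_le[OF padic_seq_abs_LIMSEQ tendsto_max[OF padic_seq_abs_LIMSEQ padic_seq_abs_LIMSEQ]])
     (auto simp: plus_padic_seq.rep_eq rat_padic_abs_ultrametric[OF prime_card])

lemma padic_seq_abs_minus: "padic_seq_abs (- X) = padic_seq_abs X"
  by transfer simp

lemma padic_seq_abs_mult: "padic_seq_abs (X * Y) = padic_seq_abs X * padic_seq_abs Y"
  using tendsto_mult[OF padic_seq_abs_LIMSEQ[of X] padic_seq_abs_LIMSEQ[of Y]] padic_seq_abs_LIMSEQ[of "X * Y"]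
  by (auto simp: times_padic_seq.rep_eq rat_padic_abs_mult[OF prime_card] dest: LIMSEQ_unique)

lift_definition padic_abs :: "'p::prime_card padic \<Rightarrow> real" is padic_seq_abs
proof -
  fix X Y :: "'p padic_seq"
  have *: "padic_seq_abs X \<le> padic_seq_abs Y" if "padic_null (X - Y)" for X Y :: "'p padic_seq"
    using padic_seq_abs_ultrametric[of "X - Y" Y] that padic_seq_abs_nonneg[of Y]
    by (simp flip: padic_seq_abs_eq_0_iff)
  assume "padic_rel X Y"
  then have "padic_null (X - Y)" "padic_null (Y - X)"
    using padic_null_minus[of "X - Y"] by (simp_all add: padic_rel_def)
  then show "padic_seq_abs X = padic_seq_abs Y"
    using *[of X Y] *[of Y X] by simp
qed

lemma padic_abs_nonneg [simp]: "padic_abs x \<ge> 0"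
  by transfer (rule padic_seq_abs_nonneg)

lemma padic_abs_eq_0_iff [simp]: "padic_abs x = 0 \<longleftrightarrow> x = 0"
  by transfer (simp add: padic_seq_abs_eq_0_iff padic_rel_def)

lemma padic_abs_mult: "padic_abs (x * y) = padic_abs x * padic_abs y"
  by transfer (rule padic_seq_abs_mult)

lemma padic_abs_minus [simp]: "padic_abs (- x) = padic_abs x"
  by transfer (rule padic_seq_abs_minus)

lemma padic_abs_ultrametric: "padic_abs (x + y) \<le> max (padic_abs x) (padic_abs y)"
  by transfer (rule padic_seq_abs_ultrametric)

lemma padic_abs_triangle: "padic_abs (x + y) \<le> padic_abs x + padic_abs y"
  using padic_abs_ultrametric[of x y] padic_abs_nonneg[of x] padic_abs_nonneg[of y] by linarith

lemma padic_abs_diff_commute: "padic_abs (x - y) = padic_abs (y - x)"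
  by (metis minus_diff_eq padic_abs_minus)

instantiation padic :: (prime_card) metric_space
begin

definition dist_padic :: "'a padic \<Rightarrow> 'a padic \<Rightarrow> real" where
  "dist_padic x y = padic_abs (x - y)"

definition uniformity_padic :: "('a padic \<times> 'a padic) filter" where
  "uniformity_padic = (INF e\<in>{0<..}. principal {(x, y). dist x y < e})"

definition open_padic :: "'a padic set \<Rightarrow> bool" where
  "open_padic U \<longleftrightarrow> (\<forall>x\<in>U. \<forall>\<^sub>F (x', y) in uniformity. x' = x \<longrightarrow> y \<in> U)"

instance
proof
  fix x y z :: "'a padic"
  show "dist x y = 0 \<longleftrightarrow> x = y"
    by (simp add: dist_padic_def)
  show "dist x y \<le> dist x z + dist y z"
    using padic_abs_triangle[of "x - z" "z - y"]
    by (simp add: dist_padic_def padic_abs_diff_commute[of z y])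
qed (rule uniformity_padic_def open_padic_def)+

end

text \<open>
  The following facts confirm that this is the usual \<open>\<rat>\<^sub>p\<close>: it contains \<open>\<rat>\<close> isometrically as a
  dense subfield and is complete.
\<close>

lift_definition padic_const_seq :: "rat \<Rightarrow> 'p::prime_card padic_seq" is "\<lambda>q n. q"
  by simp

lemma padic_const_seq_hom:
  "padic_const_seq 0 = 0" "padic_const_seq 1 = 1"
  "padic_const_seq (q + r) = padic_const_seq q + padic_const_seq r"
  "padic_const_seq (q * r) = padic_const_seq q * padic_const_seq r"
  "padic_const_seq (- q) = - padic_const_seq q"
  by (transfer; simp)+

lift_definition padic_of_rat :: "rat \<Rightarrow> 'p::prime_card padic" is padic_const_seq .

lemma padic_of_rat_hom:
  "padic_of_rat 0 = 0" "padic_of_rat 1 = 1"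
  "padic_of_rat (q + r) = padic_of_rat q + padic_of_rat r"
  "padic_of_rat (q * r) = padic_of_rat q * padic_of_rat r"
  "padic_of_rat (- q) = - padic_of_rat q"
  by (transfer, simp add: padic_const_seq_hom padic_rel_def)+

lemma padic_abs_padic_of_rat: "padic_abs (padic_of_rat q :: 'p padic) = rat_padic_abs CARD('p::prime_card) q"
  by (transfer, transfer) simp

lemma padic_of_rat_of_nat: "padic_of_rat (of_nat n) = of_nat n"
  by (induction n) (simp_all add: padic_of_rat_hom)

instance padic :: (prime_card) field_char_0
proof
  show "inj (of_nat :: nat \<Rightarrow> 'a padic)"
  proof (rule injI)
    fix m n assume "(of_nat m :: 'a padic) = of_nat n"
    then have "(padic_of_rat (of_nat m + - of_nat n) :: 'a padic) = 0"
      by (simp only: padic_of_rat_hom padic_of_rat_of_nat) simp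
    then have "rat_padic_abs CARD('a) (of_nat m + - of_nat n) = 0"
      by (simp flip: padic_abs_padic_of_rat)
    then show "m = n"
      by (simp add: rat_padic_abs_eq_0_iff[OF prime_card])
  qed
qed

lemma padic_of_rat_eq_of_rat: "(padic_of_rat q :: 'p::prime_card padic) = of_rat q"
proof -
  have int: "(padic_of_rat (of_int k) :: 'p padic) = of_int k" for k
    by (cases k rule: int_cases2) (simp_all add: padic_of_rat_of_nat padic_of_rat_hom)
  obtain a b where q: "q = of_int a / of_int b" "b > 0"
    by (cases q) (auto simp: Fract_of_int_quotient)
  then have "q * of_int b = of_int a" by simp
  then have "(padic_of_rat q :: 'p padic) * of_int b = of_int a"
    by (metis padic_of_rat_hom(4) int)
  moreover have "(of_rat q :: 'p padic) = of_int a / of_int b"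
    by (simp add: q(1) of_rat_divide)
  moreover have "(of_int b :: 'p padic) \<noteq> 0"
    using q(2) by simp
  ultimately show ?thesis
    by (metis nonzero_eq_divide_eq)
qed

lemma padic_abs_of_rat: "padic_abs (of_rat q :: 'p padic) = rat_padic_abs CARD('p::prime_card) q"
  by (simp flip: padic_of_rat_eq_of_rat add: padic_abs_padic_of_rat)

lemma padic_approx_seq:
  "(\<lambda>n. of_rat (Rep_padic_seq X n)) \<longlonglongrightarrow> abs_padic (X :: 'p::prime_card padic_seq)"
proof (rule metric_LIMSEQ_I)
  fix e :: real assume "e > 0"
  then have "e / 2 > 0" by simp
  then obtain N where N: "\<forall>m\<ge>N. \<forall>n\<ge>N. rat_padic_abs CARD('p) (Rep_padic_seq X m - Rep_padic_seq X n) < e / 2"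
    using Rep_padic_seq[of X] unfolding padic_Cauchy_def mem_Collect_eq by meson
  have "dist (of_rat (Rep_padic_seq X n)) (abs_padic X) < e" if n: "n \<ge> N" for n
  proof -
    let ?D = "padic_const_seq (Rep_padic_seq X n) - X"
    have D: "Rep_padic_seq ?D k = Rep_padic_seq X n - Rep_padic_seq X k" for k
      by (simp add: minus_padic_seq.rep_eq padic_const_seq.rep_eq)
    have "padic_seq_abs ?D \<le> e / 2"
      by (rule LIMSEQ_le_const2[OF padic_seq_abs_LIMSEQ])
         (use N n in \<open>auto simp: D intro!: exI[of _ N] less_imp_le\<close>)
    moreover have "(of_rat (Rep_padic_seq X n) :: 'p padic) - abs_padic X = abs_padic ?D"
      unfolding padic_of_rat_eq_of_rat[symmetric] padic_of_rat.abs_eq minus_padic.abs_eq ..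
    ultimately show ?thesis
      using \<open>e > 0\<close> by (simp add: dist_padic_def padic_abs.abs_eq)
  qed
  then show "\<exists>N. \<forall>n\<ge>N. dist (of_rat (Rep_padic_seq X n)) (abs_padic X) < e" by blast
qed

lemma padic_rat_dense:
  assumes "e > 0" obtains q where "dist (of_rat q) (x :: 'p::prime_card padic) < e"
proof -
  obtain X where "x = abs_padic X" by (metis Quotient_abs_rep[OF Quotient_padic])
  then show ?thesis
    using metric_LIMSEQ_D[OF padic_approx_seq[of X] assms] that by blast
qed

instance padic :: (prime_card) complete_space
proof
  fix x :: "nat \<Rightarrow> 'a padic"
  assume x: "Cauchy x"
  have "\<exists>q. dist (of_rat q) (x n) < inverse (real (Suc n))" for n
    using padic_rat_dense[of "inverse (real (Suc n))" "x n"] by auto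
  then obtain q where q: "\<And>n. dist (of_rat (q n)) (x n) < inverse (real (Suc n))" by metis
  have 0: "(\<lambda>n. dist (of_rat (q n)) (x n)) \<longlonglongrightarrow> 0"
    by (rule tendsto_sandwich[OF _ _ tendsto_const LIMSEQ_inverse_real_of_nat])
       (auto simp del: of_nat_Suc intro!: always_eventually less_imp_le q)
  have "padic_Cauchy CARD('a) q"
    unfolding padic_Cauchy_def
  proof (intro allI impI)
    fix e :: real assume "e > 0"
    then have e: "e / 3 > 0" by simp
    obtain M where M: "\<And>m n. m \<ge> M \<Longrightarrow> n \<ge> M \<Longrightarrow> dist (x m) (x n) < e / 3"
      using metric_CauchyD[OF x e] by blast
    obtain N where N: "\<And>n. n \<ge> N \<Longrightarrow> dist (of_rat (q n)) (x n) < e / 3"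
      using order_tendstoD(2)[OF 0 e] by (auto simp: eventually_sequentially)
    have "rat_padic_abs CARD('a) (q m - q n) < e" if "m \<ge> max M N" "n \<ge> max M N" for m n
    proof -
      have "rat_padic_abs CARD('a) (q m - q n) = dist (of_rat (q m)) (of_rat (q n) :: 'a padic)"
        by (simp add: dist_padic_def padic_abs_of_rat flip: of_rat_diff)
      also have "\<dots> \<le> dist (of_rat (q m)) (x m) + dist (x m) (x n) + dist (of_rat (q n)) (x n)"
        using dist_triangle[of "of_rat (q m)" "of_rat (q n)" "x m"]
          dist_triangle2[of "x m" "of_rat (q n)" "x n"] by linarith
      also have "\<dots> < e / 3 + e / 3 + e / 3"
        using M[of m n] N[of m] N[of n] that by auto
      finally show ?thesis by simp
    qed
    then show "\<exists>N. \<forall>m\<ge>N. \<forall>n\<ge>N. rat_padic_abs CARD('a) (q m - q n) < e" by blast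
  qed
  then obtain L :: "'a padic" where "(\<lambda>n. of_rat (q n)) \<longlonglongrightarrow> L"
    using padic_approx_seq[of "Abs_padic_seq q :: 'a padic_seq"] by (auto simp: Abs_padic_seq_inverse)
  from tendsto_add[OF 0 tendsto_dist_iff[THEN iffD1, OF this]]
  have *: "(\<lambda>n. dist (of_rat (q n)) (x n) + dist (of_rat (q n)) L) \<longlonglongrightarrow> 0"
    by simp
  have "(\<lambda>n. dist (x n) L) \<longlonglongrightarrow> 0"
    by (rule tendsto_sandwich[OF _ _ tendsto_const *])
       (auto intro!: always_eventually dist_triangle3)
  then have "x \<longlonglongrightarrow> L"
    by (rule tendsto_dist_iff[THEN iffD2])
  then show "convergent x" by (auto simp: convergent_def)
qed

section \<open>Characters, Haar measure and the Fourier transform on \<open>\<rat>\<^sub>p\<^sup>n\<close>\<close>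

text \<open>
  The space \<open>\<rat>\<^sub>p\<^sup>n\<close> is \<open>'p padic ^ 'n\<close> with \<open>n = CARD('n)\<close>; the topology it carries
  in the library is the product topology.
\<close>

definition padic_vec_abs :: "'p::prime_card padic ^ 'n \<Rightarrow> real" where
  "padic_vec_abs x = Max (range (\<lambda>j. padic_abs (x $ j)))"

definition padic_expansion :: "'p::prime_card padic \<Rightarrow> int \<Rightarrow> (nat \<Rightarrow> nat) \<Rightarrow> bool" where
  "padic_expansion y \<gamma> d \<longleftrightarrow>
     (\<forall>i. d i < CARD('p)) \<and> d 0 \<noteq> 0 \<and>
     (\<lambda>i. of_nat (d i) * of_nat CARD('p) powi (\<gamma> + int i)) sums y"

definition padic_frac :: "'p::prime_card padic \<Rightarrow> real" where
  "padic_frac y =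
     (if padic_abs y \<le> 1 then 0
      else (THE r. \<exists>\<gamma> d. \<gamma> < 0 \<and> padic_expansion y \<gamma> d \<and>
              r = (\<Sum>i<nat (- \<gamma>). real (d i) * real CARD('p) powi (\<gamma> + int i))))"

definition padic_char :: "'p::prime_card padic ^ 'n \<Rightarrow> 'p padic ^ 'n \<Rightarrow> complex" where
  "padic_char \<xi> x = exp (2 * of_real pi * \<i> * of_real (\<Sum>j\<in>UNIV. padic_frac (\<xi> $ j * x $ j)))"

definition normalized_Haar_measure :: "('p::prime_card padic ^ 'n) measure \<Rightarrow> bool" where
  "normalized_Haar_measure \<mu> \<longleftrightarrow>
     sets \<mu> = sets borel \<and>
     (\<forall>a. \<forall>A\<in>sets borel. emeasure \<mu> ((+) a ` A) = emeasure \<mu> A) \<and>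
     emeasure \<mu> {x. \<forall>j. padic_abs (x $ j) \<le> 1} = 1"

definition padic_test_functions :: "('p::prime_card padic ^ 'n \<Rightarrow> complex) set" where
  "padic_test_functions =
     {\<phi>. (\<forall>x. \<exists>U. open U \<and> x \<in> U \<and> (\<forall>y\<in>U. \<phi> y = \<phi> x)) \<and> compact (closure {x. \<phi> x \<noteq> 0})}"

definition padic_fourier ::
  "('p::prime_card padic ^ 'n) measure \<Rightarrow> ('p padic ^ 'n \<Rightarrow> complex) \<Rightarrow> 'p padic ^ 'n \<Rightarrow> complex" where
  "padic_fourier \<mu> \<phi> \<xi> = (\<integral>x. padic_char \<xi> x * \<phi> x \<partial>\<mu>)"

definition padic_inv_fourier ::
  "('p::prime_card padic ^ 'n) measure \<Rightarrow> ('p padic ^ 'n \<Rightarrow> complex) \<Rightarrow> 'p padic ^ 'n \<Rightarrow> complex" where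
  "padic_inv_fourier \<mu> \<psi> x = (\<integral>\<xi>. padic_char (- x) \<xi> * \<psi> \<xi> \<partial>\<mu>)"

definition padic_Lizorkin ::
  "('p::prime_card padic ^ 'n) measure \<Rightarrow> ('p padic ^ 'n \<Rightarrow> complex) set" where
  "padic_Lizorkin \<mu> = padic_fourier \<mu> ` {\<psi> \<in> padic_test_functions. \<psi> 0 = 0}"

text \<open>
  The multiplier vanishes at \<open>\<xi> = 0\<close> for every \<open>\<beta>\<close>, because \<open>0 powr \<beta> = 0\<close>.
\<close>

definition Taibleson_op ::
  "('p::prime_card padic ^ 'n) measure \<Rightarrow> complex \<Rightarrow> ('p padic ^ 'n \<Rightarrow> complex) \<Rightarrow> 'p padic ^ 'n \<Rightarrow> complex" where
  "Taibleson_op \<mu> \<beta> \<phi> =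
     padic_inv_fourier \<mu> (\<lambda>\<xi>. of_real (padic_vec_abs \<xi>) powr \<beta> * padic_fourier \<mu> \<phi> \<xi>)"

section \<open>Wavelets\<close>

definition padic_I :: "'p::prime_card padic set" where
  "padic_I =
     {of_nat CARD('p) powi (- int k) * (\<Sum>j<k. of_nat (c j) * of_nat CARD('p) ^ j) | k c.
        k \<ge> 1 \<and> (\<forall>j<k. c j < CARD('p))}"

definition padic_J :: "nat \<Rightarrow> 'p::prime_card padic set" where
  "padic_J k =
     {of_nat CARD('p) powi (- int k) * (\<Sum>j<k. of_nat (c j) * of_nat CARD('p) ^ j) | c.
        (\<forall>j<k. c j < CARD('p)) \<and> c 0 \<noteq> 0}"

definition padic_Omega :: "real \<Rightarrow> real" where
  "padic_Omega t = (if 0 \<le> t \<and> t \<le> 1 then 1 else 0)"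

definition padic_wavelet ::
  "int \<Rightarrow> 'p::prime_card padic ^ 'n \<Rightarrow> 'p padic ^ 'n \<Rightarrow> 'p padic ^ 'n \<Rightarrow> complex" where
  "padic_wavelet \<gamma> s a x =
     (let y = of_nat CARD('p) powi \<gamma> *s x - a
      in of_real (real CARD('p) powr (- (real CARD('n) * of_int \<gamma>) / 2))
         * padic_char s y * of_real (padic_Omega (padic_vec_abs y)))"

end

theory Submission
  imports Defs
begin

text \<open>
  Up to a constant, the wavelet is an atom: the character \<open>\<chi>(t \<cdot> (x - b))\<close> cut off to the polydisc
  \<open>b + B\<^sub>r\<close>, where \<open>B\<^sub>r = {x. |x| \<le> p\<^sup>r}\<close>, \<open>b = p\<^sup>-\<^sup>\<gamma> a\<close>, \<open>t = p\<^sup>\<gamma> s\<close> and \<open>r = \<gamma>\<close>. Translation invariance of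
  Haar measure shows that the integral of a character over \<open>B\<^sub>r\<close> is the volume \<open>p\<^sup>n\<^sup>r\<close> if the character is
  trivial there and vanishes otherwise, so the Fourier transform of an atom is a multiple of an atom
  supported in \<open>-t + B\<^bsub>-r\<^esub>\<close>. Since \<open>|t\<^sub>j| = p\<^bsup>m\<^sub>j - \<gamma>\<^esup> > p\<^bsup>-\<gamma>\<^esup>\<close> for every \<open>j\<close>, the norm is constant on this
  polydisc, so the multiplier acts as a scalar, and transforming back returns the wavelet.
\<close>

section \<open>The absolute value and digits\<close>

lemma prime_card_gt_1 [simp]: "Suc 0 < CARD('p::prime_card)"
  using prime_gt_1_nat[OF prime_card[where 'a='p]] by simp

lemma prime_card_neq_1 [simp]: "CARD('p::prime_card) \<noteq> Suc 0"
  using prime_card_gt_1[where 'p='p] by linarith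

lemma padic_abs_0 [simp]: "padic_abs 0 = 0"
  by (simp only: padic_abs_eq_0_iff)

lemma padic_abs_1 [simp]: "padic_abs (1 :: 'p::prime_card padic) = 1"
  using padic_abs_mult[of 1 "1 :: 'p padic"] by (metis mult_cancel_left2 mult_1 padic_abs_eq_0_iff zero_neq_one)

lemma padic_abs_power: "padic_abs (x ^ k) = padic_abs x ^ k"
  by (induction k) (simp_all add: padic_abs_mult)

lemma padic_abs_inverse: "padic_abs (inverse x) = inverse (padic_abs x)"
proof (cases "x = 0")
  case False
  then have "padic_abs x * padic_abs (inverse x) = 1"
    by (simp flip: padic_abs_mult)
  then show ?thesis by (metis inverse_unique)
qed simp

lemma padic_abs_powi: "padic_abs (x powi k) = padic_abs x powi k"
  by (simp add: power_int_def padic_abs_power padic_abs_inverse)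

lemma padic_abs_of_int:
  assumes "k \<noteq> 0"
  shows "padic_abs (of_int k :: 'p::prime_card padic) = real CARD('p) powi (- int (multiplicity (int CARD('p)) k))"
proof -
  have "padic_abs (of_int k :: 'p padic) = rat_padic_abs CARD('p) (Rat.Fract k 1)"
    by (metis of_int_rat of_rat_of_int_eq padic_abs_of_rat)
  then show ?thesis using assms by (simp add: rat_padic_abs_Fract[OF prime_card])
qed

lemma padic_abs_of_int_le_1: "padic_abs (of_int k :: 'p::prime_card padic) \<le> 1"
proof (cases "k = 0")
  case False
  have "real CARD('p) powi (- int (multiplicity (int CARD('p)) k)) \<le> real CARD('p) powi 0"
    by (rule power_int_increasing) (auto simp: Suc_leI)
  then show ?thesis using False by (simp add: padic_abs_of_int)
qed simp

lemma padic_abs_of_int_lt_1_iff: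
  "padic_abs (of_int k :: 'p::prime_card padic) < 1 \<longleftrightarrow> int CARD('p) dvd k"
proof (cases "k = 0")
  case False
  have "\<not> is_unit (int CARD('p))" using prime_card_gt_1[where 'p='p] by simp
  then have *: "multiplicity (int CARD('p)) k = 0 \<longleftrightarrow> \<not> int CARD('p) dvd k"
    using False multiplicity_eq_zero_iff by blast
  have "1 < real CARD('p)" using prime_card_gt_1[where 'p='p] by linarith
  then have "real CARD('p) powi (- int m) < 1 \<longleftrightarrow> m > 0" for m
    by (cases "m = 0") (simp_all add: power_int_minus field_simps one_less_power)
  then have "padic_abs (of_int k :: 'p padic) < 1 \<longleftrightarrow> multiplicity (int CARD('p)) k > 0"
    unfolding padic_abs_of_int[OF False] .
  then show ?thesis using * by linarith
qed simp

lemma padic_abs_p: "padic_abs (of_nat CARD('p) :: 'p::prime_card padic) = inverse (real CARD('p))"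
proof -
  have "multiplicity (int CARD('p)) (int CARD('p)) = 1"
    using prime_card_gt_1[where 'p='p] by (intro multiplicity_self) auto
  then show ?thesis using padic_abs_of_int[of "int CARD('p)", where 'p='p]
    by (simp add: power_int_minus)
qed

lemma padic_abs_p_powi:
  "padic_abs (of_nat CARD('p) powi k :: 'p::prime_card padic) = real CARD('p) powi (- k)"
  by (simp add: padic_abs_powi padic_abs_p power_int_minus power_int_inverse)

text \<open>Writing y as (x + y) + (-x), the ultrametric inequality rules out |x + y| < |y|, so the
  strictly larger term decides.\<close>

lemma padic_abs_add_eq:
  assumes "padic_abs x < padic_abs y"
  shows "padic_abs (x + y) = padic_abs y"
  using padic_abs_ultrametric[of x y] padic_abs_ultrametric[of "x + y" "- x"] assms by auto

lemma padic_abs_add_le: "padic_abs x \<le> c \<Longrightarrow> padic_abs y \<le> c \<Longrightarrow> padic_abs (x + y) \<le> c"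
  using padic_abs_ultrametric[of x y] by linarith

lemma padic_abs_diff_le: "padic_abs x \<le> c \<Longrightarrow> padic_abs y \<le> c \<Longrightarrow> padic_abs (x - y) \<le> c"
  using padic_abs_add_le[of x c "- y"] by simp

text \<open>A rational closer to x than |x| has the same absolute value as x, so the completion adds
  no new values.\<close>

lemma padic_abs_value:
  assumes "x \<noteq> 0"
  obtains k where "padic_abs (x :: 'p::prime_card padic) = real CARD('p) powi k"
proof -
  have "padic_abs x > 0" using assms by (simp add: less_le)
  then obtain q where q: "dist (of_rat q) x < padic_abs x" using padic_rat_dense by blast
  have *: "padic_abs (of_rat q :: 'p padic) = padic_abs x"
    using padic_abs_add_eq[of "of_rat q - x" x] q by (simp only: dist_padic_def diff_add_cancel)
  then have "rat_padic_abs CARD('p) q \<noteq> 0" using assms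
    by (simp flip: padic_abs_of_rat)
  then have "padic_abs x = real CARD('p) powi (int (multiplicity (int CARD('p)) (snd (quotient_of q))) -
      int (multiplicity (int CARD('p)) (fst (quotient_of q))))"
    using * by (auto simp: padic_abs_of_rat rat_padic_abs_def split: if_splits)
  then show ?thesis by (rule that)
qed

lemma prime_card_powi_le_iff [simp]:
  "real CARD('p::prime_card) powi k \<le> real CARD('p) powi l \<longleftrightarrow> k \<le> l"
proof -
  have p: "1 < real CARD('p)" using prime_card_gt_1[where 'p='p] by linarith
  show ?thesis
    using power_int_increasing[of k l "real CARD('p)"] power_int_strict_increasing[of l k "real CARD('p)"] p
    by (cases "k \<le> l") auto
qed

lemma prime_card_powi_less_iff [simp]:
  "real CARD('p::prime_card) powi k < real CARD('p) powi l \<longleftrightarrow> k < l"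
  by (simp flip: not_le)

text \<open>The value group is discrete. Digit extraction yields strict bounds, whereas polydiscs
  are given by weak ones; this converts between them.\<close>

lemma padic_abs_le_iff_less:
  "padic_abs (x :: 'p::prime_card padic) \<le> real CARD('p) powi k \<longleftrightarrow> padic_abs x < real CARD('p) powi (k + 1)"
proof (cases "x = 0")
  case True
  have "real CARD('p) powi (k + 1) > 0" by (rule zero_less_power_int) simp
  moreover have "real CARD('p) powi k \<ge> 0" by simp
  ultimately show ?thesis using True by (simp only: padic_abs_0)
next
  case False
  then obtain l where "padic_abs x = real CARD('p) powi l" by (rule padic_abs_value)
  then show ?thesis by simp
qed

text \<open>The residue field has p elements: a rational a/b in lowest terms near u has b prime to
  p, and the digit is a times the inverse of b modulo p.\<close>

lemma padic_digit:
  assumes "padic_abs (u :: 'p::prime_card padic) \<le> 1"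
  obtains d where "d < CARD('p)" "padic_abs (u - of_nat d) < 1"
proof -
  obtain q where q: "dist (of_rat q) u < 1" using padic_rat_dense[of 1] by auto
  obtain a b where ab: "q = Rat.Fract a b" "b > 0" "coprime a b" by (cases q)
  have "padic_abs ((of_rat q - u) + u) \<le> 1"
    by (rule padic_abs_add_le) (use q assms in \<open>auto simp: dist_padic_def\<close>)
  then have q1: "padic_abs (of_rat q :: 'p padic) \<le> 1" by simp
  have qb: "(of_rat q :: 'p padic) * of_int b = of_int a"
    using ab by (simp add: Fract_of_int_quotient of_rat_divide)
  \<comment> \<open>If p divided b, then |a| = |q| |b| < 1 would make p divide a as well, against
    lowest terms.\<close>
  have b: "\<not> int CARD('p) dvd b"
  proof
    assume "int CARD('p) dvd b"
    then have "padic_abs (of_int a :: 'p padic) < 1"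
      using q1 mult_left_le_one_le[of "padic_abs (of_int b :: 'p padic)" "padic_abs (of_rat q :: 'p padic)"]
      by (simp add: padic_abs_mult flip: qb padic_abs_of_int_lt_1_iff)
    then have "int CARD('p) dvd a" by (simp add: padic_abs_of_int_lt_1_iff)
    with \<open>int CARD('p) dvd b\<close> ab(3) have "is_unit (int CARD('p))" using coprime_common_divisor by blast
    then show False using prime_card_gt_1[where 'p='p] by simp
  qed
  then have "coprime b (int CARD('p))"
    using prime_imp_coprime[OF prime_card_int] coprime_commute by blast
  then obtain c where "[b * c = 1] (mod int CARD('p))" using cong_solve_coprime_int by auto
  then have "[b * c * a = 1 * a] (mod int CARD('p))" by (rule cong_mult) simp
  then have "[b * (c * a mod int CARD('p)) = a] (mod int CARD('p))"
    by (simp add: cong_def mod_mult_right_eq mult.assoc)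
  then have dv: "int CARD('p) dvd a - b * (c * a mod int CARD('p))"
    using cong_iff_dvd_diff cong_sym by blast
  define d where "d = nat (c * a mod int CARD('p))"
  have d: "int d = c * a mod int CARD('p)" "d < CARD('p)"
    using prime_card_gt_1[where 'p='p] by (auto simp: d_def nat_less_iff)
  \<comment> \<open>Since b is a unit, multiplying by it clears the denominator without changing the
    absolute value.\<close>
  have "padic_abs (of_int b :: 'p padic) = 1"
    using b padic_abs_of_int_lt_1_iff[of b, where 'p='p] padic_abs_of_int_le_1[of b, where 'p='p] by linarith
  then have "padic_abs (of_rat q - of_nat d :: 'p padic) = padic_abs ((of_rat q - of_nat d) * of_int b :: 'p padic)"
    by (simp add: padic_abs_mult)
  also have "(of_rat q - of_nat d) * of_int b = (of_int (a - b * int d) :: 'p padic)"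
    using qb by (simp add: algebra_simps)
  also have "padic_abs \<dots> < 1" using dv d by (simp only: padic_abs_of_int_lt_1_iff)
  finally have "padic_abs (of_rat q - of_nat d :: 'p padic) < 1" .
  moreover have "padic_abs (u - of_rat q) < 1"
    using q by (simp add: dist_padic_def padic_abs_diff_commute)
  ultimately have "padic_abs ((u - of_rat q) + (of_rat q - of_nat d)) < 1"
    using padic_abs_ultrametric[of "u - of_rat q" "of_rat q - of_nat d"] by linarith
  then show ?thesis using that d(2) by simp
qed

section \<open>Expansions and the fractional part\<close>

text \<open>After scaling y to a unit u, digits are split off one at a time, each remainder being
  divided by p.\<close>

lemma padic_expansion_exists:
  assumes "y \<noteq> 0"
  obtains \<gamma> d where "padic_expansion (y :: 'p::prime_card padic) \<gamma> d" "padic_abs y = real CARD('p) powi (- \<gamma>)"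
proof -
  define P :: "'p padic" where "P = of_nat CARD('p)"
  have P: "P \<noteq> 0" "\<And>k. padic_abs (P powi k) = real CARD('p) powi (- k)"
    by (simp_all add: P_def padic_abs_p_powi)
  have aP: "padic_abs P = inverse (real CARD('p))" by (simp add: P_def padic_abs_p)
  obtain k where k: "padic_abs y = real CARD('p) powi k" using padic_abs_value[OF assms] .
  define \<gamma> where "\<gamma> = - k"
  define u where "u = y * P powi k"
  have u: "padic_abs u = 1"
    by (simp add: u_def padic_abs_mult k P flip: power_int_add)
  have "\<forall>v :: 'p padic. \<exists>d. padic_abs v \<le> 1 \<longrightarrow> d < CARD('p) \<and> padic_abs (v - of_nat d) < 1"
    using padic_digit by metis
  then obtain D where D: "\<And>v :: 'p padic. padic_abs v \<le> 1 \<Longrightarrow> D v < CARD('p) \<and> padic_abs (v - of_nat (D v)) < 1"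
    by metis
  \<comment> \<open>\<open>U i\<close> is the remainder after i digits; its residue
    \<open>D (U i)\<close> is the next digit.\<close>
  define U where "U = rec_nat u (\<lambda>_ v. (v - of_nat (D v)) / P)"
  have U0: "U 0 = u" and US: "U (Suc i) = (U i - of_nat (D (U i))) / P" for i
    by (simp_all add: U_def)
  have U: "padic_abs (U i) \<le> 1" for i
  proof (induction i)
    case (Suc i)
    \<comment> \<open>Strictly below 1 means at most 1/p, so division by \<open>P\<close> keeps the
      remainder integral.\<close>
    have "padic_abs (U i - of_nat (D (U i))) \<le> real CARD('p) powi (- 1)"
      using D[OF Suc] unfolding padic_abs_le_iff_less by simp
    then have "padic_abs (U i - of_nat (D (U i))) * real CARD('p) \<le> real CARD('p) powi (- 1) * real CARD('p)"
      by (rule mult_right_mono) simp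
    also have "real CARD('p) powi (- 1) * real CARD('p) = 1" by (simp add: power_int_minus)
    finally show ?case
      by (simp add: US divide_inverse padic_abs_mult padic_abs_inverse aP)
  qed (simp add: U0 u)
  define d where "d i = D (U i)" for i
  have "u = (\<Sum>i<n. of_nat (d i) * P ^ i) + P ^ n * U n" for n
  proof (induction n)
    case (Suc n)
    have "U n = of_nat (d n) + P * U (Suc n)" using P by (simp add: US d_def)
    then show ?case using Suc by (simp add: algebra_simps)
  qed (simp add: U0)
  then have "P powi \<gamma> * u = P powi \<gamma> * ((\<Sum>i<n. of_nat (d i) * P ^ i) + P ^ n * U n)" for n
    by (rule arg_cong)
  then have "P powi \<gamma> * u = P powi \<gamma> * (\<Sum>i<n. of_nat (d i) * P ^ i) + P powi \<gamma> * P ^ n * U n" for n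
    by (simp only: distrib_left mult.assoc)
  moreover have "P powi \<gamma> * u = y"
    using P by (simp add: u_def \<gamma>_def flip: power_int_add)
  moreover have "P powi \<gamma> * P ^ n = P powi (\<gamma> + int n)" for n
    using P by (simp add: power_int_add)
  moreover have "P powi \<gamma> * (\<Sum>i<n. of_nat (d i) * P ^ i) = (\<Sum>i<n. of_nat (d i) * P powi (\<gamma> + int i))" for n
    using P by (simp add: sum_distrib_left power_int_add mult_ac)
  ultimately have eq: "y = (\<Sum>i<n. of_nat (d i) * P powi (\<gamma> + int i)) + P powi (\<gamma> + int n) * U n" for n
    by simp
  \<comment> \<open>The error after n digits is the term containing \<open>U n\<close>, and
    \<open>U n\<close> is integral.\<close>
  have bound: "dist (\<Sum>i<n. of_nat (d i) * P powi (\<gamma> + int i)) y \<le> real CARD('p) powi (- \<gamma>) * inverse (real CARD('p)) ^ n" for n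
  proof -
    have "dist (\<Sum>i<n. of_nat (d i) * P powi (\<gamma> + int i)) y = padic_abs (P powi (\<gamma> + int n) * U n)"
      unfolding dist_padic_def padic_abs_diff_commute[of _ y] by (subst eq[of n]) simp
    also have "\<dots> \<le> padic_abs (P powi (\<gamma> + int n))"
      using U by (simp add: padic_abs_mult mult_left_le)
    also have "\<dots> = real CARD('p) powi (- \<gamma>) * inverse (real CARD('p)) ^ n"
      unfolding P by (simp add: power_int_add power_int_diff power_int_minus power_inverse field_simps)
    finally show ?thesis .
  qed
  have "(\<lambda>n. real CARD('p) powi (- \<gamma>) * inverse (real CARD('p)) ^ n) \<longlonglongrightarrow> real CARD('p) powi (- \<gamma>) * 0"
    using prime_card_gt_1[where 'p='p]
    by (intro tendsto_mult_left LIMSEQ_realpow_zero) (auto simp: inverse_less_1_iff)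
  then have lim: "(\<lambda>n. real CARD('p) powi (- \<gamma>) * inverse (real CARD('p)) ^ n) \<longlonglongrightarrow> 0"
    by (simp only: mult_zero_right)
  have "(\<lambda>n. dist (\<Sum>i<n. of_nat (d i) * P powi (\<gamma> + int i)) y) \<longlonglongrightarrow> 0"
    by (rule Lim_null_comparison[OF _ lim])
      (simp only: real_norm_def abs_of_nonneg[OF zero_le_dist] bound eventually_True)
  then have "(\<lambda>i. of_nat (d i) * P powi (\<gamma> + int i)) sums y"
    unfolding sums_def by (rule tendsto_dist_iff[THEN iffD2])
  \<comment> \<open>A zero leading digit would give |u| < 1.\<close>
  moreover have "d 0 \<noteq> 0"
  proof
    assume "d 0 = 0"
    then have "padic_abs (u - of_nat 0) < 1" using D[of u] u by (simp only: d_def U0)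
    then show False using u by simp
  qed
  moreover have "d i < CARD('p)" for i using D[OF U] by (simp add: d_def)
  ultimately have "padic_expansion y \<gamma> d"
    by (auto simp: padic_expansion_def P_def)
  with that k show ?thesis by (simp add: \<gamma>_def)
qed

lemma padic_abs_sum_le:
  assumes "\<And>i. i \<in> A \<Longrightarrow> padic_abs (f i) \<le> c" "0 \<le> c"
  shows "padic_abs (sum f A) \<le> c"
  using assms by (induction A rule: infinite_finite_induct) (auto intro: padic_abs_add_le)

text \<open>Terms of index at least N are integral, and y is within 1 of some partial sum beyond N;
  the ultrametric inequality combines the two.\<close>

lemma padic_expansion_truncate:
  assumes "padic_expansion (y :: 'p::prime_card padic) (- int N) d"
  shows "padic_abs (y - (\<Sum>i<N. of_nat (d i) * of_nat CARD('p) powi (- int N + int i))) \<le> 1"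
proof -
  define t :: "nat \<Rightarrow> 'p padic" where "t = (\<lambda>i. of_nat (d i) * of_nat CARD('p) powi (- int N + int i))"
  have "(\<lambda>n. sum t {..<n}) \<longlonglongrightarrow> y"
    using assms by (simp add: padic_expansion_def sums_def t_def)
  then obtain M where M: "\<And>n. n \<ge> M \<Longrightarrow> dist (sum t {..<n}) y < 1"
    by (metis metric_LIMSEQ_D zero_less_one)
  define n where "n = max M N"
  have "sum t {..<n} = sum t {..<N} + sum t {N..<n}"
    by (metis n_def max.cobounded2 lessThan_atLeast0 sum.atLeastLessThan_concat zero_le)
  then have "y - sum t {..<N} = sum t {N..<n} - (sum t {..<n} - y)"
    by simp
  moreover have "padic_abs (sum t {N..<n}) \<le> 1"
  proof (rule padic_abs_sum_le)
    fix i assume "i \<in> {N..<n}"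
    then have "real CARD('p) powi (- (- int N + int i)) \<le> real CARD('p) powi 0"
      unfolding prime_card_powi_le_iff by simp
    then show "padic_abs (t i) \<le> 1"
      using mult_mono[OF padic_abs_of_int_le_1[of "int (d i)", where 'p='p], of _ 1] padic_abs_nonneg
      by (simp only: t_def padic_abs_mult padic_abs_p_powi of_int_of_nat_eq) simp
  qed simp
  moreover have "padic_abs (sum t {..<n} - y) \<le> 1"
    using M[of n] by (simp add: n_def dist_padic_def)
  ultimately have "padic_abs (y - sum t {..<N}) \<le> 1"
    by (simp only: padic_abs_diff_le)
  then show ?thesis by (simp only: t_def)
qed

lemma padic_abs_int_over_power_le_1D:
  assumes "padic_abs (of_int k / of_nat CARD('p) ^ N :: 'p::prime_card padic) \<le> 1"
  shows "int CARD('p) ^ N dvd k"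
proof (cases "k = 0")
  case False
  have "padic_abs (of_int k :: 'p padic) = padic_abs ((of_int k / of_nat CARD('p) ^ N) * of_nat CARD('p) powi int N :: 'p padic)"
    by simp
  also have "\<dots> \<le> 1 * real CARD('p) powi (- int N)"
    unfolding padic_abs_mult padic_abs_p_powi by (rule mult_right_mono[OF assms]) simp
  finally have "padic_abs (of_int k :: 'p padic) \<le> real CARD('p) powi (- int N)" by simp
  then have "N \<le> multiplicity (int CARD('p)) k"
    using False by (simp add: padic_abs_of_int)
  then show ?thesis by (rule multiplicity_dvd')
qed simp

lemma digit_sum_less_power:
  assumes "\<And>i. i < N \<Longrightarrow> d i < (p :: nat)"
  shows "(\<Sum>i<N. d i * p ^ i) < p ^ N"
  using assms
proof (induction N)
  case (Suc N)
  have "(\<Sum>i<N. d i * p ^ i) < p ^ N" using Suc by simp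
  moreover have "d N * p ^ N + p ^ N \<le> p * p ^ N"
    using mult_le_mono1[of "Suc (d N)" p "p ^ N"] Suc.prems[of N] by simp
  ultimately show ?case by simp
qed simp

text \<open>The fractions differ by k / p^(N+M). Integrality makes p^(N+M) divide k, while both
  fractions lie in [0,1), so k is smaller than that in size and must be 0. This takes the place of
  uniqueness of digits in showing that \<open>padic_frac\<close> is well defined.\<close>

lemma padic_fraction_unique:
  assumes "padic_abs (y - of_nat K / of_nat CARD('p) ^ N :: 'p::prime_card padic) \<le> 1" "K < CARD('p) ^ N"
    and "padic_abs (y - of_nat L / of_nat CARD('p) ^ M) \<le> 1" "L < CARD('p) ^ M"
  shows "real K / real CARD('p) ^ N = real L / real CARD('p) ^ M"
proof -
  let ?p = "CARD('p)"
  define k where "k = int K * int ?p ^ M - int L * int ?p ^ N"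
  have "padic_abs (of_nat K / of_nat ?p ^ N - of_nat L / of_nat ?p ^ M :: 'p padic) \<le> 1"
    using padic_abs_diff_le[OF assms(3,1)] by simp
  also have "(of_nat K / of_nat ?p ^ N - of_nat L / of_nat ?p ^ M :: 'p padic) = of_int k / of_nat ?p ^ (N + M)"
    by (simp add: k_def field_simps power_add)
  finally have dv: "int ?p ^ (N + M) dvd k" by (rule padic_abs_int_over_power_le_1D)
  have "int K * int ?p ^ M < int ?p ^ N * int ?p ^ M" "int L * int ?p ^ N < int ?p ^ M * int ?p ^ N"
    using assms(2,4) by (simp_all flip: of_nat_power of_nat_mult)
  moreover have "0 \<le> int K * int ?p ^ M" "0 \<le> int L * int ?p ^ N" by simp_all
  ultimately have "\<bar>k\<bar> < int ?p ^ (N + M)"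
    unfolding k_def power_add abs_less_iff mult.commute[of "int ?p ^ M" "int ?p ^ N"] by linarith
  then have "k = 0" using dv dvd_imp_le_int[of k "int ?p ^ (N + M)"] by linarith
  then have "real_of_int (int K * int ?p ^ M) = real_of_int (int L * int ?p ^ N)"
    by (simp only: k_def right_minus_eq)
  then have "real K * real ?p ^ M = real L * real ?p ^ N"
    by (simp only: of_int_mult of_int_power of_int_of_nat_eq)
  then show ?thesis by (intro frac_eq_eq[THEN iffD2]) simp_all
qed

text \<open>Removes the definite description: from here on the fractional part is known as a
  fraction in [0,1) congruent to y modulo the p-adic integers, in both branches of the
  definition.\<close>

lemma padic_frac_cases:
  obtains K N where "K < CARD('p) ^ N" "padic_frac (y :: 'p::prime_card padic) = real K / real CARD('p) ^ N"
    "padic_abs (y - of_nat K / of_nat CARD('p) ^ N) \<le> 1"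
proof (cases "padic_abs y \<le> 1")
  case True
  then have "padic_frac y = 0" by (simp only: padic_frac_def if_True)
  then show ?thesis using that[of 0 0] True by simp
next
  case False
  let ?p = "CARD('p)"
  \<comment> \<open>Any expansion of negative order yields such a fraction; \<open>K\<close> reads
    its first digits in base p.\<close>
  have 1: "\<exists>K N. K < ?p ^ N \<and> (\<Sum>i<nat (- \<gamma>). real (d i) * real ?p powi (\<gamma> + int i)) = real K / real ?p ^ N
          \<and> padic_abs (y - of_nat K / of_nat ?p ^ N) \<le> 1"
    if "\<gamma> < 0" "padic_expansion y \<gamma> d" for \<gamma> d
  proof -
    define N where "N = nat (- \<gamma>)"
    have \<gamma>: "\<gamma> = - int N" using that(1) by (simp add: N_def)
    define K where "K = (\<Sum>i<N. d i * ?p ^ i)"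
    \<comment> \<open>Stated over any field, since it serves both in the reals and in the p-adic
      numbers.\<close>
    have pw: "x powi (int i - int N) = x ^ i / x ^ N" if "x \<noteq> 0" for i and x :: "'c::field"
      using that by (simp add: power_int_add power_int_diff divide_inverse)
    have "K < ?p ^ N"
      unfolding K_def by (rule digit_sum_less_power) (use that(2) in \<open>simp add: padic_expansion_def\<close>)
    moreover have "(\<Sum>i<N. real (d i) * real ?p powi (- int N + int i)) = real K / real ?p ^ N"
      by (simp add: K_def pw sum_divide_distrib)
    moreover have "(\<Sum>i<N. of_nat (d i) * of_nat ?p powi (- int N + int i)) = (of_nat K / of_nat ?p ^ N :: 'p padic)"
      by (simp add: K_def pw sum_divide_distrib)
    ultimately show ?thesis
      using padic_expansion_truncate[of y N d] that(2) unfolding \<gamma> by auto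
  qed
  obtain \<gamma> d where e: "padic_expansion y \<gamma> d" "padic_abs y = real ?p powi (- \<gamma>)"
    using padic_expansion_exists[of y] False by (metis padic_abs_0 zero_le_one)
  have "real ?p powi 0 < real ?p powi (- \<gamma>)" using False e by simp
  then have "\<gamma> < 0" unfolding prime_card_powi_less_iff by simp
  let ?R = "\<lambda>r. \<exists>\<gamma> d. \<gamma> < 0 \<and> padic_expansion y \<gamma> d \<and> r = (\<Sum>i<nat (- \<gamma>). real (d i) * real ?p powi (\<gamma> + int i))"
  \<comment> \<open>Two candidates come from possibly different expansions, but their fractions are
    congruent to the same y and hence equal.\<close>
  have "\<exists>!r. ?R r"
  proof (rule ex_ex1I)
    show "\<exists>r. ?R r" using e \<open>\<gamma> < 0\<close> by blast
    fix r r' assume "?R r" "?R r'"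
    then obtain \<gamma> d \<gamma>' d' where *: "\<gamma> < 0" "padic_expansion y \<gamma> d" "\<gamma>' < 0" "padic_expansion y \<gamma>' d'"
      "r = (\<Sum>i<nat (- \<gamma>). real (d i) * real ?p powi (\<gamma> + int i))"
      "r' = (\<Sum>i<nat (- \<gamma>'). real (d' i) * real ?p powi (\<gamma>' + int i))" by blast
    show "r = r'"
      using 1[OF *(1,2)] 1[OF *(3,4)] padic_fraction_unique[of y] unfolding *(5,6)[symmetric] by auto
  qed
  then have "?R (THE r. ?R r)" by (rule theI')
  then have "?R (padic_frac y)" using False by (simp only: padic_frac_def if_False)
  then obtain \<gamma> d where *: "\<gamma> < 0" "padic_expansion y \<gamma> d"
      "padic_frac y = (\<Sum>i<nat (- \<gamma>). real (d i) * real ?p powi (\<gamma> + int i))" by blast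
  show ?thesis
    using 1[OF *(1,2)] that unfolding *(3)[symmetric] by blast
qed

section \<open>The additive character in one variable and its kernel\<close>

definition padic_unit_char :: "'p::prime_card padic \<Rightarrow> complex" where
  "padic_unit_char y = exp (2 * of_real pi * \<i> * of_real (padic_frac y))"

text \<open>Two fractions congruent to y differ by an ordinary integer, which the exponential
  ignores. So \<open>k\<close> may be any integer, as is needed for sums of fractional
  parts.\<close>

lemma padic_unit_char_eq:
  assumes "padic_abs (y - of_int k / of_nat CARD('p) ^ N :: 'p::prime_card padic) \<le> 1"
  shows "padic_unit_char y = exp (2 * of_real pi * \<i> * of_real (of_int k / real CARD('p) ^ N))"
proof -
  let ?p = "CARD('p)"
  obtain L M where L: "padic_frac y = real L / real ?p ^ M" "padic_abs (y - of_nat L / of_nat ?p ^ M) \<le> 1"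
    by (rule padic_frac_cases)
  have "padic_abs (of_nat L / of_nat ?p ^ M - of_int k / of_nat ?p ^ N :: 'p padic) \<le> 1"
    using padic_abs_diff_le[OF assms L(2)] by simp
  also have "(of_nat L / of_nat ?p ^ M - of_int k / of_nat ?p ^ N :: 'p padic)
      = of_int (int L * int ?p ^ N - k * int ?p ^ M) / of_nat ?p ^ (N + M)"
    by (simp add: field_simps power_add)
  finally have "int ?p ^ (N + M) dvd int L * int ?p ^ N - k * int ?p ^ M"
    by (rule padic_abs_int_over_power_le_1D)
  then obtain j where "int L * int ?p ^ N - k * int ?p ^ M = int ?p ^ (N + M) * j" by (rule dvdE)
  then have "real_of_int (int L * int ?p ^ N - k * int ?p ^ M) = real_of_int (int ?p ^ (N + M) * j)" by simp
  then have "padic_frac y = of_int k / real ?p ^ N + of_int j"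
    unfolding L by (simp add: field_simps power_add)
  then have "2 * of_real pi * \<i> * of_real (padic_frac y)
      = 2 * of_real pi * \<i> * of_real (of_int k / real ?p ^ N) + (2 * of_int j * pi) * \<i>"
    by (simp add: algebra_simps)
  moreover have "exp ((2 * of_int j * pi) * \<i>) = 1" using exp_integer_2pi[of "of_int j"] by simp
  ultimately show ?thesis unfolding padic_unit_char_def by (simp only: exp_add) simp
qed

text \<open>The fractional part is additive only up to an integer, but the sum of the two fractions
  still represents x + y modulo the p-adic integers.\<close>

lemma padic_unit_char_add: "padic_unit_char (x + y) = padic_unit_char x * padic_unit_char (y :: 'p::prime_card padic)"
proof -
  let ?p = "CARD('p)"
  obtain K N where x: "padic_frac x = real K / real ?p ^ N" "padic_abs (x - of_nat K / of_nat ?p ^ N) \<le> 1"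
    by (rule padic_frac_cases)
  obtain L M where y: "padic_frac y = real L / real ?p ^ M" "padic_abs (y - of_nat L / of_nat ?p ^ M) \<le> 1"
    by (rule padic_frac_cases)
  define k where "k = int K * int ?p ^ M + int L * int ?p ^ N"
  have "padic_abs ((x - of_nat K / of_nat ?p ^ N) + (y - of_nat L / of_nat ?p ^ M)) \<le> 1"
    by (rule padic_abs_add_le) fact+
  also have "(x - of_nat K / of_nat ?p ^ N) + (y - of_nat L / of_nat ?p ^ M) = (x + y) - of_int k / of_nat ?p ^ (N + M)"
    by (simp add: k_def field_simps power_add)
  finally have "padic_unit_char (x + y) = exp (2 * of_real pi * \<i> * of_real (of_int k / real ?p ^ (N + M)))"
    by (rule padic_unit_char_eq)
  also have "of_int k / real ?p ^ (N + M) = padic_frac x + padic_frac y"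
    unfolding x y by (simp add: k_def field_simps power_add)
  finally show ?thesis by (simp add: padic_unit_char_def distrib_left exp_add)
qed

lemma padic_unit_char_eq_1_iff: "padic_unit_char (y :: 'p::prime_card padic) = 1 \<longleftrightarrow> padic_abs y \<le> 1"
proof
  assume "padic_abs y \<le> 1"
  then show "padic_unit_char y = 1" using padic_unit_char_eq[of y 0 0] by simp
next
  assume 1: "padic_unit_char y = 1"
  let ?p = "CARD('p)"
  obtain K N where K: "K < ?p ^ N" "padic_frac y = real K / real ?p ^ N" "padic_abs (y - of_nat K / of_nat ?p ^ N) \<le> 1"
    by (rule padic_frac_cases)
  \<comment> \<open>The fractional part is now an integer in [0,1), so its numerator
    \<open>K\<close> vanishes and y is integral.\<close>
  obtain j :: int where "2 * pi * padic_frac y = of_int (2 * j) * pi"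
    using 1 by (auto simp: padic_unit_char_def exp_eq_1)
  then have j: "padic_frac y = of_int j" by simp
  moreover have "real K < real ?p ^ N" using K(1) by (simp flip: of_nat_power)
  then have "0 \<le> padic_frac y" "padic_frac y < 1" by (simp_all add: K(2))
  ultimately have "j = 0" by simp
  then have "K = 0" using j K(2) by simp
  show "padic_abs y \<le> 1" using K(3) unfolding \<open>K = 0\<close> by simp
qed

section \<open>Polydiscs\<close>

text \<open>These are the compact open subgroups p^(-r) Z_p^n. Indexing by the exponent turns
  scaling and duality into integer arithmetic.\<close>

definition padic_box :: "int \<Rightarrow> ('p::prime_card padic ^ 'n) set" where
  "padic_box r = {x. \<forall>j. padic_abs (x $ j) \<le> real CARD('p) powi r}"

lemma padic_box_0 [simp]: "0 \<in> padic_box r"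
  by (simp add: padic_box_def)

lemma padic_box_minus_iff [simp]: "- x \<in> padic_box r \<longleftrightarrow> x \<in> padic_box r"
  by (simp add: padic_box_def)

lemma padic_box_add: "x \<in> padic_box r \<Longrightarrow> y \<in> padic_box r \<Longrightarrow> x + y \<in> padic_box r"
  by (simp add: padic_box_def padic_abs_add_le)

lemma padic_box_diff: "x \<in> padic_box r \<Longrightarrow> y \<in> padic_box r \<Longrightarrow> x - y \<in> padic_box r"
  by (simp add: padic_box_def padic_abs_diff_le)

lemma padic_box_add_iff: "x \<in> padic_box r \<Longrightarrow> x + y \<in> padic_box r \<longleftrightarrow> y \<in> padic_box r"
  using padic_box_add[of x r y] padic_box_diff[of "x + y" r x] by auto

lemma padic_box_diff_commute: "x - y \<in> padic_box r \<longleftrightarrow> y - x \<in> padic_box r"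
  using padic_box_minus_iff[of "x - y" r] by simp

lemma padic_box_mono:
  assumes "r \<le> s" shows "padic_box r \<subseteq> (padic_box s :: ('p::prime_card padic ^ 'n) set)"
proof -
  have "real CARD('p) powi r \<le> real CARD('p) powi s" using assms by simp
  then show ?thesis unfolding padic_box_def by (auto intro: order_trans)
qed

lemma padic_box_cover:
  obtains r where "(x :: 'p::prime_card padic ^ 'n) \<in> padic_box r"
proof -
  have "\<exists>k. padic_abs (x $ j) \<le> real CARD('p) powi k" for j
  proof (cases "x $ j = 0")
    case True
    then show ?thesis by (metis padic_abs_0 zero_le_power_int of_nat_0_le_iff)
  next
    case False
    then show ?thesis by (metis padic_abs_value order_refl)
  qed
  then obtain k where k: "\<And>j. padic_abs (x $ j) \<le> real CARD('p) powi k j" by metis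
  have "padic_abs (x $ j) \<le> real CARD('p) powi (Max (range k))" for j
    by (rule order_trans[OF k]) simp
  then show ?thesis using that[of "Max (range k)"] by (simp add: padic_box_def)
qed

text \<open>Such a set is a union of cosets of an open subgroup. Applied to complements the
  criterion gives closedness, applied to preimages the continuity of locally constant
  functions.\<close>

lemma open_padic_box_saturated:
  fixes S :: "('p::prime_card padic ^ 'n) set"
  assumes "\<And>x y. x \<in> S \<Longrightarrow> y - x \<in> padic_box r \<Longrightarrow> y \<in> S"
  shows "open S"
  unfolding open_dist
proof (intro ballI exI conjI allI impI)
  show "0 < real CARD('p) powi r" by (rule zero_less_power_int) simp
  fix x y assume x: "x \<in> S" and d: "dist y x < real CARD('p) powi r"
  have "y - x \<in> padic_box r"
    unfolding padic_box_def
  proof (intro CollectI allI)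
    \<comment> \<open>The library distance on vectors dominates the distance in each
      coordinate.\<close>
    fix j
    show "padic_abs ((y - x) $ j) \<le> real CARD('p) powi r"
      using dist_vec_nth_le[of y j x] d by (simp add: dist_padic_def)
  qed
  with x assms show "y \<in> S" by blast
qed

lemma open_padic_box: "open {x. x - a \<in> padic_box r}"
proof (rule open_padic_box_saturated)
  fix x y assume "x \<in> {x. x - a \<in> padic_box r}" "y - x \<in> padic_box r"
  then show "y \<in> {x. x - a \<in> padic_box r}"
    using padic_box_add[of "y - x" r "x - a"] by simp
qed

lemma closed_padic_box: "closed {x. x - a \<in> padic_box r}"
  unfolding closed_def
proof (rule open_padic_box_saturated)
  fix x y assume "x \<in> - {x. x - a \<in> padic_box r}" "y - x \<in> padic_box r"
  then show "y \<in> - {x. x - a \<in> padic_box r}"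
    using padic_box_diff[of "y - a" r "y - x"] by auto
qed

lemma padic_box_borel [measurable]: "padic_box r \<in> sets borel"
  using borel_closed[OF closed_padic_box[of 0 r]] by simp

lemma continuous_on_padic_box_invariant:
  fixes f :: "'p::prime_card padic ^ 'n \<Rightarrow> 'b::topological_space"
  assumes "\<And>x y. y - x \<in> padic_box r \<Longrightarrow> f y = f x"
  shows "continuous_on A f"
proof -
  have "open (f -` S)" for S
    by (rule open_padic_box_saturated[where r = r]) (use assms in auto)
  then have "continuous_on UNIV f"
    by (simp add: continuous_on_open_vimage)
  then show ?thesis by (rule continuous_on_subset) simp
qed

lemma padic_vec_dist_translate: "dist (a + x) (a + y) = dist x (y :: 'p::prime_card padic ^ 'n)"
  by (simp add: dist_vec_def dist_padic_def)

lemma continuous_on_padic_translate: "continuous_on A ((+) (a :: 'p::prime_card padic ^ 'n))"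
  unfolding continuous_on_iff padic_vec_dist_translate by blast

lemma measurable_padic_translate: "(+) (a :: 'p::prime_card padic ^ 'n) \<in> borel_measurable borel"
  by (rule borel_measurable_continuous_onI[OF continuous_on_padic_translate])

section \<open>Cosets\<close>

text \<open>With digits below p, these represent the cosets of \<open>padic_box (r - 1)\<close> in
  \<open>padic_box r\<close>.\<close>

definition padic_digit_vec :: "int \<Rightarrow> ('n \<Rightarrow> nat) \<Rightarrow> 'p::prime_card padic ^ 'n" where
  "padic_digit_vec r c = (\<chi> j. of_nat CARD('p) powi (- r) * of_nat (c j))"

lemma image_translate_padic_box: "(+) a ` padic_box r = {x. x - a \<in> padic_box r}"
proof (intro equalityI subsetI)
  fix x assume "x \<in> {x. x - a \<in> padic_box r}"
  then show "x \<in> (+) a ` padic_box r" by (intro image_eqI[of _ _ "x - a"]) auto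
qed auto

text \<open>Scaling by p^r makes each coordinate integral, and \<open>padic_digit\<close> then
  supplies its residue modulo p.\<close>

lemma padic_box_cosets:
  "(padic_box r :: ('p::prime_card padic ^ 'n) set) =
     (\<Union>c\<in>(UNIV \<rightarrow>\<^sub>E {..<CARD('p)}). (+) (padic_digit_vec r c) ` padic_box (r - 1))"
proof (intro equalityI subsetI)
  fix x :: "'p padic ^ 'n" assume x: "x \<in> padic_box r"
  have "\<exists>d. d < CARD('p) \<and> padic_abs (x $ j - of_nat CARD('p) powi (- r) * of_nat d) \<le> real CARD('p) powi (r - 1)" for j
  proof -
    have "padic_abs (x $ j * of_nat CARD('p) powi r) \<le> real CARD('p) powi r * real CARD('p) powi (- r)"
      unfolding padic_abs_mult padic_abs_p_powi
      by (rule mult_right_mono) (use x in \<open>auto simp: padic_box_def\<close>)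
    then have "padic_abs (x $ j * of_nat CARD('p) powi r) \<le> 1"
      by (simp flip: power_int_add)
    then obtain d where d: "d < CARD('p)" "padic_abs (x $ j * of_nat CARD('p) powi r - of_nat d) < 1"
      by (rule padic_digit)
    have "x $ j - of_nat CARD('p) powi (- r) * of_nat d = of_nat CARD('p) powi (- r) * (x $ j * of_nat CARD('p) powi r - of_nat d)"
      by (simp add: algebra_simps power_int_minus)
    then have "padic_abs (x $ j - of_nat CARD('p) powi (- r) * of_nat d)
        = real CARD('p) powi r * padic_abs (x $ j * of_nat CARD('p) powi r - of_nat d)"
      by (simp only: padic_abs_mult padic_abs_p_powi minus_minus)
    also have "\<dots> < real CARD('p) powi r * 1"
      by (rule mult_strict_left_mono[OF d(2)]) (rule zero_less_power_int, simp)
    finally have "padic_abs (x $ j - of_nat CARD('p) powi (- r) * of_nat d) \<le> real CARD('p) powi (r - 1)"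
      unfolding padic_abs_le_iff_less by simp
    with d show ?thesis by blast
  qed
  then obtain c where c: "\<And>j. c j < CARD('p)"
    "\<And>j. padic_abs (x $ j - of_nat CARD('p) powi (- r) * of_nat (c j)) \<le> real CARD('p) powi (r - 1)"
    by metis
  then have "x - padic_digit_vec r c \<in> padic_box (r - 1)"
    by (simp add: padic_box_def padic_digit_vec_def)
  with c(1) show "x \<in> (\<Union>c\<in>(UNIV \<rightarrow>\<^sub>E {..<CARD('p)}). (+) (padic_digit_vec r c) ` padic_box (r - 1))"
    unfolding image_translate_padic_box by blast
next
  fix x :: "'p padic ^ 'n"
  assume "x \<in> (\<Union>c\<in>(UNIV \<rightarrow>\<^sub>E {..<CARD('p)}). (+) (padic_digit_vec r c) ` padic_box (r - 1))"
  then obtain c y where x: "x = padic_digit_vec r c + y" "y \<in> padic_box (r - 1)" by blast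
  have "padic_digit_vec r c \<in> (padic_box r :: ('p padic ^ 'n) set)"
    unfolding padic_box_def
  proof (intro CollectI allI)
    fix j
    have "padic_abs (padic_digit_vec r c $ j :: 'p padic) = real CARD('p) powi r * padic_abs (of_int (int (c j)) :: 'p padic)"
      by (simp add: padic_digit_vec_def padic_abs_mult padic_abs_p_powi)
    also have "\<dots> \<le> real CARD('p) powi r * 1"
      by (rule mult_left_mono[OF padic_abs_of_int_le_1]) simp
    finally show "padic_abs (padic_digit_vec r c $ j :: 'p padic) \<le> real CARD('p) powi r" by simp
  qed
  moreover have "y \<in> padic_box r" using x(2) padic_box_mono[of "r - 1" r] by auto
  ultimately show "x \<in> padic_box r" using x(1) padic_box_add by blast
qed

text \<open>Distinct digits differ by an integer prime to p, so two representatives are p^r apart in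
  some coordinate, too far for a common coset.\<close>

lemma padic_box_cosets_disjoint:
  "disjoint_family_on (\<lambda>c. (+) (padic_digit_vec r c) ` (padic_box (r - 1) :: ('p::prime_card padic ^ 'n) set))
     (UNIV \<rightarrow>\<^sub>E {..<CARD('p)})"
proof (unfold disjoint_family_on_def image_translate_padic_box, intro ballI impI equals0I)
  fix c c' :: "'n \<Rightarrow> nat" and x :: "'p padic ^ 'n"
  assume c: "c \<in> UNIV \<rightarrow>\<^sub>E {..<CARD('p)}" "c' \<in> UNIV \<rightarrow>\<^sub>E {..<CARD('p)}" "c \<noteq> c'"
    and x: "x \<in> {x. x - padic_digit_vec r c \<in> padic_box (r - 1)} \<inter> {x. x - padic_digit_vec r c' \<in> padic_box (r - 1)}"
  obtain j where j: "c j \<noteq> c' j" using c(3) by blast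
  have "(x - padic_digit_vec r c) - (x - padic_digit_vec r c') \<in> padic_box (r - 1)"
    by (rule padic_box_diff) (use x in auto)
  then have "padic_abs ((padic_digit_vec r c' - padic_digit_vec r c :: 'p padic ^ 'n) $ j) \<le> real CARD('p) powi (r - 1)"
    unfolding padic_box_def by simp
  also have "(padic_digit_vec r c' - padic_digit_vec r c :: 'p padic ^ 'n) $ j
      = of_nat CARD('p) powi (- r) * of_int (int (c' j) - int (c j))"
    by (simp add: padic_digit_vec_def algebra_simps)
  also have "padic_abs \<dots> = real CARD('p) powi r * padic_abs (of_int (int (c' j) - int (c j)) :: 'p padic)"
    by (simp only: padic_abs_mult padic_abs_p_powi minus_minus)
  finally have *: "real CARD('p) powi r * padic_abs (of_int (int (c' j) - int (c j)) :: 'p padic) \<le> real CARD('p) powi (r - 1)" .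
  have "\<bar>int (c' j) - int (c j)\<bar> < int CARD('p)"
  proof -
    have "c j < CARD('p)" "c' j < CARD('p)" using c by auto
    then show ?thesis by linarith
  qed
  then have "\<not> int CARD('p) dvd int (c' j) - int (c j)"
    using j dvd_imp_le_int[of "int (c' j) - int (c j)" "int CARD('p)"] by auto
  then have "padic_abs (of_int (int (c' j) - int (c j)) :: 'p padic) = 1"
    using padic_abs_of_int_lt_1_iff padic_abs_of_int_le_1 by (metis less_le)
  then have "real CARD('p) powi r \<le> real CARD('p) powi (r - 1)" using * by simp
  then show False unfolding prime_card_powi_le_iff by simp
qed

section \<open>Total boundedness and compactness of polydiscs\<close>

lemma finite_padic_digits: "finite ((UNIV :: 'n::finite set) \<rightarrow>\<^sub>E {..<k :: nat})"
  by (intro finite_PiE) auto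

text \<open>Each of the k steps splits every polydisc into p^n cosets of the next smaller
  one.\<close>

lemma padic_box_finite_cover:
  "\<exists>F. finite F \<and> padic_box r \<subseteq> (\<Union>a\<in>F. {x :: 'p::prime_card padic ^ 'n. x - a \<in> padic_box (r - int k)})"
proof (induction k)
  case 0
  then show ?case by (intro exI[of _ "{0}"]) simp
next
  case (Suc k)
  then obtain F where F: "finite F" "padic_box r \<subseteq> (\<Union>a\<in>F. {x :: 'p padic ^ 'n. x - a \<in> padic_box (r - int k)})"
    by blast
  let ?G = "(\<lambda>(a, c). a + padic_digit_vec (r - int k) c) ` (F \<times> (UNIV \<rightarrow>\<^sub>E {..<CARD('p)}))"
  have "\<exists>g\<in>?G. x - g \<in> padic_box (r - int (Suc k))" if x: "x \<in> padic_box r" for x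
  proof -
    obtain a where a: "a \<in> F" "x - a \<in> padic_box (r - int k)" using F x by blast
    then obtain c where c: "c \<in> UNIV \<rightarrow>\<^sub>E {..<CARD('p)}" and "x - a \<in> (+) (padic_digit_vec (r - int k) c) ` padic_box (r - int k - 1)"
      using padic_box_cosets[of "r - int k", where 'p='p and 'n='n] by blast
    moreover have "r - int k - 1 = r - int (Suc k)" by simp
    ultimately have "x - (a + padic_digit_vec (r - int k) c) \<in> padic_box (r - int (Suc k))"
      unfolding image_translate_padic_box by (simp only: mem_Collect_eq diff_diff_eq)
    with a(1) c show ?thesis
      by (intro bexI[of _ "a + padic_digit_vec (r - int k) c"]) auto
  qed
  moreover have "finite ?G" using F(1) finite_padic_digits by blast
  ultimately show ?case by (intro exI[of _ ?G]) blast
qed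

text \<open>The library distance on vectors is at most the sum of the n coordinate distances.
  \<open>M\<close> bounds that sum at exponent r, and each refinement divides the bound by
  p.\<close>

lemma padic_box_subset_ball:
  assumes "e > 0"
  shows "\<exists>k. \<forall>a :: 'p::prime_card padic ^ 'n. {x. x - a \<in> padic_box (r - int k)} \<subseteq> ball a e"
proof -
  define M where "M = real CARD('n) * real CARD('p) powi r"
  have M: "M > 0" unfolding M_def by (intro mult_pos_pos zero_less_power_int) auto
  obtain k where k: "inverse (real CARD('p)) ^ k < e / M"
    using real_arch_pow_inv[of "e / M" "inverse (real CARD('p))"] M assms prime_card_gt_1[where 'p='p]
    by (auto simp: inverse_less_1_iff)
  have "x \<in> ball a e" if x: "x - a \<in> padic_box (r - int k)" for a x :: "'p padic ^ 'n"
  proof -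
    have "dist a x \<le> (\<Sum>j\<in>UNIV. dist (a $ j) (x $ j))"
      unfolding dist_vec_def by (rule L2_set_le_sum) simp
    also have "\<dots> \<le> (\<Sum>j\<in>(UNIV :: 'n set). real CARD('p) powi (r - int k))"
      using x by (intro sum_mono) (simp add: dist_padic_def padic_abs_diff_commute padic_box_def)
    also have "\<dots> = M * inverse (real CARD('p)) ^ k"
      by (simp add: M_def power_int_diff power_inverse divide_inverse)
    also have "\<dots> < e" using mult_strict_left_mono[OF k M] M by simp
    finally show ?thesis by simp
  qed
  then show ?thesis by blast
qed

lemma compact_padic_box: "compact (padic_box r :: ('p::prime_card padic ^ 'n) set)"
  unfolding compact_eq_totally_bounded
proof (intro conjI allI impI)
  show "complete (padic_box r :: ('p padic ^ 'n) set)"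
    using closed_padic_box[of 0 r] by (simp add: complete_eq_closed)
  fix e :: real assume "e > 0"
  then obtain k where k: "\<And>a :: 'p padic ^ 'n. {x. x - a \<in> padic_box (r - int k)} \<subseteq> ball a e"
    using padic_box_subset_ball by blast
  obtain F where "finite F" "padic_box r \<subseteq> (\<Union>a\<in>F. {x :: 'p padic ^ 'n. x - a \<in> padic_box (r - int k)})"
    using padic_box_finite_cover by blast
  then show "\<exists>F. finite F \<and> (padic_box r :: ('p padic ^ 'n) set) \<subseteq> (\<Union>a\<in>F. ball a e)"
    using k by (intro exI[of _ F]) blast
qed

lemma compact_padic_box_translate: "compact {x :: 'p::prime_card padic ^ 'n. x - a \<in> padic_box r}"
  unfolding image_translate_padic_box[symmetric]
  by (rule compact_continuous_image[OF continuous_on_padic_translate compact_padic_box])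

section \<open>Haar measure\<close>

text \<open>A polydisc consists of p^n disjoint translates of the next smaller one, so each step
  scales the measure by p^n. The induction runs both ways from the normalization at exponent
  0.\<close>

lemma emeasure_padic_box:
  assumes "normalized_Haar_measure (\<mu> :: ('p::prime_card padic ^ 'n) measure)"
  shows "emeasure \<mu> (padic_box r) = ennreal (real CARD('p) powi (int CARD('n) * r))"
proof -
  have sets: "sets \<mu> = sets borel"
    and inv: "\<And>a A. A \<in> sets borel \<Longrightarrow> emeasure \<mu> ((+) a ` A) = emeasure \<mu> A"
    and 1: "emeasure \<mu> (padic_box 0) = 1"
    using assms by (auto simp: normalized_Haar_measure_def padic_box_def)
  let ?q = "real CARD('p) ^ CARD('n)"
  have q: "?q > 0" by simp
  have step: "emeasure \<mu> (padic_box r) = ennreal ?q * emeasure \<mu> (padic_box (r - 1))" for r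
  proof -
    have "emeasure \<mu> (padic_box r) = (\<Sum>c\<in>((UNIV :: 'n set) \<rightarrow>\<^sub>E {..<CARD('p)}). emeasure \<mu> ((+) (padic_digit_vec r c) ` padic_box (r - 1)))"
      by (subst padic_box_cosets, rule sum_emeasure[symmetric])
        (use padic_box_cosets_disjoint finite_padic_digits borel_closed[OF closed_padic_box] in
          \<open>auto simp: sets image_translate_padic_box\<close>)
    also have "\<dots> = of_nat (card ((UNIV :: 'n set) \<rightarrow>\<^sub>E {..<CARD('p)})) * emeasure \<mu> (padic_box (r - 1))"
      by (simp add: inv)
    also have "of_nat (card ((UNIV :: 'n set) \<rightarrow>\<^sub>E {..<CARD('p)})) = ennreal ?q"
      by (simp add: card_PiE ennreal_of_nat_eq_real_of_nat)
    finally show ?thesis .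
  qed
  show ?thesis
  proof (induction r rule: int_induct[where k = 0])
    case base
    then show ?case using 1 by simp
  next
    case (step1 i)
    have "emeasure \<mu> (padic_box (i + 1)) = ennreal ?q * ennreal (real CARD('p) powi (int CARD('n) * i))"
      using step[of "i + 1"] step1 by simp
    also have "\<dots> = ennreal (?q * real CARD('p) powi (int CARD('n) * i))"
      by (simp add: ennreal_mult)
    also have "?q * real CARD('p) powi (int CARD('n) * i) = real CARD('p) powi (int CARD('n) * (i + 1))"
      by (simp add: distrib_left power_int_add)
    finally show ?case .
  next
    case (step2 i)
    have "ennreal ?q * emeasure \<mu> (padic_box (i - 1)) = ennreal (real CARD('p) powi (int CARD('n) * i))"
      using step[of i] step2 by simp
    also have "real CARD('p) powi (int CARD('n) * i) = ?q * real CARD('p) powi (int CARD('n) * (i - 1))"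
      by (simp add: right_diff_distrib power_int_diff)
    also have "ennreal \<dots> = ennreal ?q * ennreal (real CARD('p) powi (int CARD('n) * (i - 1)))"
      by (simp add: ennreal_mult)
    \<comment> \<open>Cancellation in the extended nonnegative reals is sound because the factor is
      positive and finite.\<close>
    finally show ?case
      using q by (subst (asm) ennreal_mult_cancel_left) (auto simp: ennreal_eq_0_iff)
  qed
qed

lemma integral_padic_translate:
  fixes f :: "'p::prime_card padic ^ 'n \<Rightarrow> complex"
  assumes "normalized_Haar_measure \<mu>" "f \<in> borel_measurable borel"
  shows "(\<integral>x. f (a + x) \<partial>\<mu>) = (\<integral>x. f x \<partial>\<mu>)"
proof -
  have sets: "sets \<mu> = sets borel"
    and inv: "\<And>a A. A \<in> sets borel \<Longrightarrow> emeasure \<mu> ((+) a ` A) = emeasure \<mu> A"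
    using assms(1) by (auto simp: normalized_Haar_measure_def)
  have m: "(+) a \<in> measurable \<mu> \<mu>"
    using measurable_padic_translate[of a] measurable_cong_sets[OF sets sets] by blast
  have sp: "space \<mu> = UNIV" using sets_eq_imp_space_eq[OF sets] by simp
  have "distr \<mu> \<mu> ((+) a) = \<mu>"
  proof (rule measure_eqI)
    fix A assume "A \<in> sets (distr \<mu> \<mu> ((+) a))"
    then have A: "A \<in> sets \<mu>" by simp
    \<comment> \<open>Invariance is given for images, whereas the push-forward measure uses
      preimages.\<close>
    have "(+) a -` A = (+) (- a) ` A"
    proof (intro equalityI subsetI)
      fix x assume "x \<in> (+) a -` A"
      then show "x \<in> (+) (- a) ` A" by (intro image_eqI[of _ _ "a + x"]) auto
    qed auto
    then show "emeasure (distr \<mu> \<mu> ((+) a)) A = emeasure \<mu> A"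
      using A inv[of A "- a"] by (simp add: emeasure_distr[OF m A] sp sets)
  qed simp
  moreover have "(\<integral>x. f x \<partial>distr \<mu> \<mu> ((+) a)) = (\<integral>x. f (a + x) \<partial>\<mu>)"
    using assms(2) measurable_cong_sets[OF sets refl] by (intro integral_distr[OF m]) blast
  ultimately show ?thesis by simp
qed

section \<open>Characters on polydiscs\<close>

lemma padic_char_eq_prod: "padic_char \<xi> x = (\<Prod>j\<in>UNIV. padic_unit_char (\<xi> $ j * x $ j))"
  by (simp add: padic_char_def padic_unit_char_def sum_distrib_left exp_sum)

lemma padic_char_commute: "padic_char \<xi> x = padic_char x \<xi>"
  by (simp add: padic_char_def mult.commute)

lemma padic_char_add_right: "padic_char \<xi> (x + y) = padic_char \<xi> x * padic_char \<xi> y"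
  by (simp add: padic_char_eq_prod distrib_left padic_unit_char_add prod.distrib)

lemma padic_char_add_left: "padic_char (\<xi> + \<eta>) x = padic_char \<xi> x * padic_char \<eta> x"
  by (simp add: padic_char_commute[of _ x] padic_char_add_right)

lemma padic_char_minus_swap: "padic_char (- \<xi>) x = padic_char \<xi> (- x)"
  by (simp add: padic_char_def)

text \<open>The polydiscs of exponents r and -r are dual: all coordinate products are
  integral.\<close>

lemma padic_char_eq_1:
  assumes "\<xi> \<in> padic_box r" "x \<in> padic_box (- r)"
  shows "padic_char (\<xi> :: 'p::prime_card padic ^ 'n) x = 1"
proof -
  have "padic_abs (\<xi> $ j * x $ j) \<le> 1" for j
  proof -
    have "padic_abs (\<xi> $ j) * padic_abs (x $ j) \<le> real CARD('p) powi r * real CARD('p) powi (- r)"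
      using assms by (intro mult_mono) (auto simp: padic_box_def)
    then show ?thesis by (simp add: padic_abs_mult flip: power_int_add)
  qed
  then show ?thesis by (simp add: padic_char_eq_prod padic_unit_char_eq_1_iff[THEN iffD2])
qed

lemma padic_char_0_left [simp]: "padic_char 0 x = 1"
proof -
  obtain r where "x \<in> padic_box r" by (rule padic_box_cover)
  then show ?thesis using padic_char_eq_1[of 0 "- r" x] by simp
qed

lemma padic_char_0_right [simp]: "padic_char \<xi> 0 = 1"
  by (simp add: padic_char_commute[of \<xi>])

lemma padic_char_mult_minus [simp]: "padic_char \<xi> x * padic_char (- \<xi>) x = 1"
  using padic_char_add_left[of \<xi> "- \<xi>" x] by simp

lemma padic_char_nontrivial:
  assumes "\<xi> \<notin> padic_box (- r)"
  obtains x where "x \<in> padic_box r" "padic_char (\<xi> :: 'p::prime_card padic ^ 'n) x \<noteq> 1"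
proof -
  obtain j where j: "real CARD('p) powi (- r) < padic_abs (\<xi> $ j)"
    using assms by (auto simp: padic_box_def not_le)
  define u :: "'p padic" where "u = of_nat CARD('p) powi (- r)"
  have u: "padic_abs u = real CARD('p) powi r" by (simp only: u_def padic_abs_p_powi minus_minus)
  \<comment> \<open>The witness is concentrated in a coordinate where \<xi> exceeds the dual radius;
    its entry is as large as the polydisc allows, which pushes the product out of the p-adic
    integers.\<close>
  define x where "x = (\<chi> i. if i = j then u else 0)"
  have "padic_char \<xi> x = (\<Prod>i\<in>UNIV. if i = j then padic_unit_char (\<xi> $ j * u) else 1)"
    unfolding padic_char_eq_prod by (intro prod.cong) (auto simp: x_def padic_unit_char_eq_1_iff)
  then have "padic_char \<xi> x = padic_unit_char (\<xi> $ j * u)" by simp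
  moreover have "real CARD('p) powi (- r) * real CARD('p) powi r < padic_abs (\<xi> $ j) * real CARD('p) powi r"
    by (rule mult_strict_right_mono[OF j]) (rule zero_less_power_int, simp)
  then have "1 < padic_abs (\<xi> $ j * u)"
    by (simp add: padic_abs_mult u flip: power_int_add)
  ultimately have "padic_char \<xi> x \<noteq> 1" by (simp add: padic_unit_char_eq_1_iff)
  moreover have "x \<in> padic_box r" by (simp add: padic_box_def x_def u)
  ultimately show ?thesis using that by blast
qed

text \<open>The character is constant on cosets of the polydisc dual to one containing
  \<xi>.\<close>

lemma padic_char_measurable: "padic_char \<xi> \<in> borel_measurable borel"
proof -
  obtain r where r: "\<xi> \<in> padic_box r" by (rule padic_box_cover)
  have "padic_char \<xi> y = padic_char \<xi> x" if "y - x \<in> padic_box (- r)" for x y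
    using padic_char_add_right[of \<xi> x "y - x"] padic_char_eq_1[OF r that] by simp
  then show ?thesis
    by (intro borel_measurable_continuous_onI continuous_on_padic_box_invariant)
qed

lemma integral_padic_char_box:
  assumes \<mu>: "normalized_Haar_measure (\<mu> :: ('p::prime_card padic ^ 'n) measure)"
  shows "(\<integral>x. padic_char \<xi> x * indicator (padic_box r) x \<partial>\<mu>) =
    of_real (real CARD('p) powi (int CARD('n) * r)) * indicator (padic_box (- r)) \<xi>"
proof (cases "\<xi> \<in> padic_box (- r)")
  case True
  have sets: "sets \<mu> = sets borel" using \<mu> by (simp add: normalized_Haar_measure_def)
  have "(\<integral>x. padic_char \<xi> x * indicator (padic_box r) x \<partial>\<mu>) = (\<integral>x. complex_of_real (indicator (padic_box r) x) \<partial>\<mu>)"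
    using padic_char_eq_1[OF True] by (intro Bochner_Integration.integral_cong) (auto simp: indicator_def)
  also have "\<dots> = of_real (measure \<mu> (padic_box r))"
    using sets_eq_imp_space_eq[OF sets] by (simp only: integral_complex_of_real integral_indicator) simp
  also have "measure \<mu> (padic_box r) = real CARD('p) powi (int CARD('n) * r)"
    by (simp add: measure_def emeasure_padic_box[OF \<mu>])
  finally show ?thesis using True by simp
next
  case False
  then obtain a where a: "a \<in> padic_box r" "padic_char \<xi> a \<noteq> 1" by (rule padic_char_nontrivial)
  let ?f = "\<lambda>x. padic_char \<xi> x * indicator (padic_box r) x"
  \<comment> \<open>The shift by \<open>a\<close> preserves the polydisc and multiplies the
    integrand by a constant other than 1, so the integral is 0.\<close>
  have "(\<integral>x. ?f x \<partial>\<mu>) = (\<integral>x. ?f (a + x) \<partial>\<mu>)"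
    by (rule integral_padic_translate[OF \<mu>, symmetric])
      (intro borel_measurable_times padic_char_measurable borel_measurable_indicator padic_box_borel)
  also have "\<dots> = (\<integral>x. padic_char \<xi> a * ?f x \<partial>\<mu>)"
    using padic_box_add_iff[OF a(1)] by (simp add: padic_char_add_right indicator_def mult.assoc)
  also have "\<dots> = padic_char \<xi> a * (\<integral>x. ?f x \<partial>\<mu>)" by simp
  finally have "(\<integral>x. ?f x \<partial>\<mu>) = 0" using a(2) by simp
  then show ?thesis using False by simp
qed

section \<open>Atoms and their Fourier transforms\<close>

definition padic_atom :: "'p::prime_card padic ^ 'n \<Rightarrow> 'p padic ^ 'n \<Rightarrow> int \<Rightarrow> 'p padic ^ 'n \<Rightarrow> complex" where
  "padic_atom b t r x = padic_char t (x - b) * indicator (padic_box r) (x - b)"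

lemma padic_fourier_cmult: "padic_fourier \<mu> (\<lambda>x. c * \<phi> x) \<xi> = c * padic_fourier \<mu> \<phi> \<xi>"
  unfolding padic_fourier_def by (simp add: mult.left_commute[of _ c])

text \<open>Shifting by the centre leaves the integral of the character of \<xi> + t over a polydisc
  at 0. Centre and frequency thus trade places, up to sign and a constant phase.\<close>

lemma padic_fourier_atom:
  assumes \<mu>: "normalized_Haar_measure (\<mu> :: ('p::prime_card padic ^ 'n) measure)"
  shows "padic_fourier \<mu> (padic_atom b t r) \<xi> =
    of_real (real CARD('p) powi (int CARD('n) * r)) * padic_char (- b) t * padic_atom (- t) b (- r) \<xi>"
proof -
  let ?f = "\<lambda>x. padic_char \<xi> x * padic_atom b t r x"
  have "(+) (- b) = (\<lambda>x. x - b)" by (rule ext) simp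
  then have sub: "(\<lambda>x. x - b) \<in> borel_measurable borel"
    using measurable_padic_translate[of "- b"] by metis
  have "?f \<in> borel_measurable borel"
    unfolding padic_atom_def
    by (intro borel_measurable_times padic_char_measurable measurable_compose[OF sub padic_char_measurable]
        measurable_compose[OF sub borel_measurable_indicator] padic_box_borel)
  then have "(\<integral>x. ?f x \<partial>\<mu>) = (\<integral>x. ?f (b + x) \<partial>\<mu>)"
    by (rule integral_padic_translate[OF \<mu>, symmetric])
  also have "\<dots> = (\<integral>x. padic_char \<xi> b * (padic_char (\<xi> + t) x * indicator (padic_box r) x) \<partial>\<mu>)"
    by (simp add: padic_atom_def padic_char_add_right padic_char_add_left mult_ac)
  also have "\<dots> = padic_char \<xi> b * (\<integral>x. padic_char (\<xi> + t) x * indicator (padic_box r) x \<partial>\<mu>)"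
    by simp
  also have "\<dots> = of_real (real CARD('p) powi (int CARD('n) * r)) * padic_char \<xi> b * indicator (padic_box (- r)) (\<xi> + t)"
    by (simp add: integral_padic_char_box[OF \<mu>])
  \<comment> \<open>Rebases the phase at the new centre \<open>- t\<close>, so that the result has
    the shape of an atom.\<close>
  also have "padic_char \<xi> b = padic_char (- b) t * padic_char b (\<xi> + t)"
    using padic_char_mult_minus[of b t]
    by (simp add: padic_char_commute[of \<xi>] padic_char_add_right mult_ac)
  finally show ?thesis by (simp add: padic_fourier_def padic_atom_def mult_ac)
qed

lemma padic_atom_test_function: "(\<lambda>x. c * padic_atom b t r x) \<in> padic_test_functions"
  unfolding padic_test_functions_def
proof (intro CollectI conjI allI)
  fix x
  obtain s where s: "t \<in> padic_box s" by (rule padic_box_cover)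
  \<comment> \<open>The cutoff is constant on cosets at exponent r and the character at exponent -s;
    the smaller exponent serves both.\<close>
  define k where "k = min r (- s)"
  show "\<exists>U. open U \<and> x \<in> U \<and> (\<forall>y\<in>U. c * padic_atom b t r y = c * padic_atom b t r x)"
  proof (intro exI[of _ "{y. y - x \<in> padic_box k}"] conjI ballI open_padic_box)
    fix y assume "y \<in> {y. y - x \<in> padic_box k}"
    then have y: "y - x \<in> padic_box r" "y - x \<in> padic_box (- s)"
      using padic_box_mono[of k r] padic_box_mono[of k "- s"] by (auto simp: k_def)
    have "padic_char t (y - b) = padic_char t (x - b)"
      using padic_char_add_right[of t "y - x" "x - b"] padic_char_eq_1[OF s y(2)] by simp
    moreover have "y - b \<in> padic_box r \<longleftrightarrow> x - b \<in> padic_box r"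
      using padic_box_add_iff[OF y(1), of "x - b"] by simp
    ultimately show "c * padic_atom b t r y = c * padic_atom b t r x"
      by (simp add: padic_atom_def indicator_def)
  qed simp
next
  have "{x. c * padic_atom b t r x \<noteq> 0} \<subseteq> {x. x - b \<in> padic_box r}"
    by (auto simp: padic_atom_def indicator_def split: if_splits)
  then have "closure {x. c * padic_atom b t r x \<noteq> 0} \<subseteq> {x. x - b \<in> padic_box r}"
    by (rule closure_minimal[OF _ closed_padic_box])
  from Int_absorb1[OF this] show "compact (closure {x. c * padic_atom b t r x \<noteq> 0})"
    using compact_Int_closed[OF compact_padic_box_translate closed_closure] by metis
qed

section \<open>Wavelets as atoms\<close>

text \<open>The digits form an integer congruent to \<open>c 0\<close> modulo p, hence a unit, so
  only the factor p^(-k) counts. The bound \<open>k \<ge> 1\<close> makes \<open>c 0\<close> one of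
  the summed digits.\<close>

lemma padic_abs_padic_J:
  assumes "s \<in> padic_J k" "k \<ge> 1"
  shows "padic_abs (s :: 'p::prime_card padic) = real CARD('p) powi int k"
proof -
  obtain c where s: "s = of_nat CARD('p) powi (- int k) * (\<Sum>j<k. of_nat (c j) * of_nat CARD('p) ^ j)"
    and c: "\<forall>j<k. c j < CARD('p)" "c 0 \<noteq> 0"
    using assms(1) by (auto simp: padic_J_def)
  define K where "K = (\<Sum>j<k. c j * CARD('p) ^ j)"
  obtain l where k: "k = Suc l" using assms(2) by (cases k) auto
  have "K = c 0 + CARD('p) * (\<Sum>j<l. c (Suc j) * CARD('p) ^ j)"
    by (simp add: K_def k sum.lessThan_Suc_shift sum_distrib_left mult_ac del: sum.lessThan_Suc)
  then have "CARD('p) dvd K \<longleftrightarrow> CARD('p) dvd c 0" by (simp add: dvd_add_left_iff)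
  moreover have "c 0 < CARD('p)" using c(1) assms(2) by auto
  then have "\<not> CARD('p) dvd c 0" using c(2) by (auto dest: nat_dvd_not_less)
  ultimately have "\<not> int CARD('p) dvd int K" by (simp only: of_nat_dvd_iff) blast
  then have "padic_abs (of_int (int K) :: 'p padic) = 1"
    using padic_abs_of_int_lt_1_iff padic_abs_of_int_le_1 by (metis less_le)
  moreover have "s = of_nat CARD('p) powi (- int k) * of_int (int K)"
    by (simp add: s K_def)
  ultimately show ?thesis by (simp only: padic_abs_mult padic_abs_p_powi minus_minus mult_1_right)
qed

lemma padic_Omega_vec_abs: "padic_Omega (padic_vec_abs y) = indicator (padic_box 0) y"
proof -
  have "padic_vec_abs y \<le> 1 \<longleftrightarrow> y \<in> padic_box 0"
    by (auto simp: padic_vec_abs_def padic_box_def)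
  moreover have "0 \<le> padic_vec_abs y"
    unfolding padic_vec_abs_def by (rule order_trans[OF padic_abs_nonneg Max_ge]) auto
  ultimately show ?thesis by (simp add: padic_Omega_def indicator_def)
qed

text \<open>Factoring p^\<gamma> out of p^\<gamma> x - a exposes the centre; the factor then moves
  onto s inside the character and enlarges the unit polydisc to exponent \<gamma>.\<close>

lemma padic_wavelet_eq_atom:
  "padic_wavelet \<gamma> s a x = of_real (real CARD('p) powr (- (real CARD('n) * of_int \<gamma>) / 2)) *
     padic_atom (of_nat CARD('p) powi (- \<gamma>) *s a) (of_nat CARD('p) powi \<gamma> *s s) \<gamma> (x :: 'p::prime_card padic ^ 'n)"
proof -
  define P :: "'p padic" where "P = of_nat CARD('p) powi \<gamma>"
  have P: "P \<noteq> 0" "padic_abs P = real CARD('p) powi (- \<gamma>)"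
    by (simp_all add: P_def padic_abs_p_powi)
  have iP: "of_nat CARD('p) powi (- \<gamma>) = inverse P" by (simp add: P_def power_int_minus)
  define z where "z = x - inverse P *s a"
  have y: "P *s x - a = P *s z"
    using P(1) by (simp add: z_def vec_eq_iff right_diff_distrib)
  have "padic_char s (P *s z) = padic_char (P *s s) z"
    by (simp add: padic_char_def mult_ac)
  moreover have "P *s z \<in> padic_box 0 \<longleftrightarrow> z \<in> padic_box \<gamma>"
  proof -
    have "padic_abs (P * u) \<le> 1 \<longleftrightarrow> padic_abs u \<le> real CARD('p) powi \<gamma>" for u
      by (simp add: padic_abs_mult P power_int_minus divide_simps)
    then show ?thesis by (simp add: padic_box_def)
  qed
  ultimately show ?thesis
    unfolding padic_wavelet_def Let_def P_def[symmetric] iP y padic_Omega_vec_abs padic_atom_def z_def[symmetric]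
    by (simp add: indicator_def)
qed

text \<open>In every coordinate \<xi> is -t plus a strictly smaller term, so it inherits the
  absolute value of t. Powers of p are monotone in the exponent, so the maximum passes to the
  exponents.\<close>

lemma padic_vec_abs_shell:
  assumes t: "\<And>j. padic_abs (t $ j) = real CARD('p) powi (k j)" "\<And>j. r < k j"
    and \<xi>: "\<xi> + t \<in> padic_box r"
  shows "padic_vec_abs (\<xi> :: 'p::prime_card padic ^ 'n) = real CARD('p) powi (Max (range k))"
proof -
  have "padic_abs (\<xi> $ j) = real CARD('p) powi (k j)" for j
  proof -
    have "padic_abs ((\<xi> + t) $ j) \<le> real CARD('p) powi r" using \<xi> by (simp add: padic_box_def)
    also have "\<dots> < padic_abs (- t $ j)" using t(2)[of j] by (simp add: t(1))
    finally have "padic_abs ((\<xi> + t) $ j + (- t $ j)) = padic_abs (- t $ j)" by (rule padic_abs_add_eq)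
    then show ?thesis by (simp add: t(1))
  qed
  then have "padic_vec_abs \<xi> = Max (range (\<lambda>j. real CARD('p) powi (k j)))"
    by (simp add: padic_vec_abs_def)
  also have "\<dots> = real CARD('p) powi (Max (range k))"
  proof (rule Max_eqI)
    have "Max (range k) \<in> range k" by (rule Max_in) auto
    then obtain j where "Max (range k) = k j" by blast
    then show "real CARD('p) powi (Max (range k)) \<in> range (\<lambda>j. real CARD('p) powi (k j))"
      by (intro image_eqI[of _ _ j]) simp_all
  qed auto
  finally show ?thesis .
qed

text \<open>Both bases are positive reals, where the principal logarithm is the real one, so no
  branch correction appears.\<close>

lemma of_real_powi_powr:
  assumes "p > 0"
  shows "complex_of_real (real p powi k) powr \<beta> = of_nat p powr (\<beta> * of_int k)"
proof -
  have pos: "0 < real p powi k" using assms by (intro zero_less_power_int) simp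
  have "ln (real p powi k) = of_int k * ln (real p)"
    using assms by (simp add: ln_powr flip: powr_real_of_int')
  then have "Ln (complex_of_real (real p powi k)) = of_int k * Ln (complex_of_real (real p))"
    using assms pos by (simp add: Ln_of_real del: of_real_power_int of_real_of_nat_eq)
  moreover have "complex_of_real (real p powi k) \<noteq> 0" using assms by simp
  ultimately show ?thesis using assms by (simp add: powr_def mult_ac)
qed

text \<open>The first two conjuncts give the word eigenfunction its content: the wavelet lies in the
  domain of the operator and is not zero.\<close>

theorem mainTheorem4:
  fixes \<mu> :: "('p::prime_card padic ^ 'n) measure"
    and m :: "'n \<Rightarrow> nat" and \<beta> :: complex and \<gamma> :: int
    and s a :: "'p padic ^ 'n"
  assumes "CARD('n) \<ge> 2"
    and "normalized_Haar_measure \<mu>"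
    and "\<And>j. m j \<ge> 1"
    and "\<And>j. s $ j \<in> padic_J (m j)"
    and "\<And>j. a $ j \<in> padic_I"
  shows "padic_wavelet \<gamma> s a \<in> padic_Lizorkin \<mu> \<and>
         padic_wavelet \<gamma> s a \<noteq> (\<lambda>x. 0) \<and>
         (\<forall>x. Taibleson_op \<mu> \<beta> (padic_wavelet \<gamma> s a) x =
                of_nat CARD('p) powr (\<beta> * of_int (int (Max (range m)) - \<gamma>)) * padic_wavelet \<gamma> s a x)"
proof (intro conjI allI)
  define b where "b = of_nat CARD('p) powi (- \<gamma>) *s a"
  define t where "t = of_nat CARD('p) powi \<gamma> *s s"
  define K where "K = complex_of_real (real CARD('p) powr (- (real CARD('n) * of_int \<gamma>) / 2))"
  define q where "q = complex_of_real (real CARD('p) powi (int CARD('n) * \<gamma>))"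
  have q': "complex_of_real (real CARD('p) powi (int CARD('n) * - \<gamma>)) = inverse q"
    by (simp add: q_def power_int_minus)
  have q0: "q \<noteq> 0" by (simp add: q_def)
  have W: "padic_wavelet \<gamma> s a = (\<lambda>x. K * padic_atom b t \<gamma> x)"
    by (rule ext) (simp only: padic_wavelet_eq_atom K_def b_def t_def)
  have t: "padic_abs (t $ j) = real CARD('p) powi (int (m j) - \<gamma>)" for j
    using padic_abs_padic_J[OF assms(4,3), of j]
    by (simp add: t_def padic_abs_mult padic_abs_p_powi power_int_diff power_int_minus divide_inverse mult.commute)
  \<comment> \<open>Here \<open>m j \<ge> 1\<close> places the frequency strictly outside the dual
    polydisc in every coordinate.\<close>
  have lt: "- \<gamma> < int (m j) - \<gamma>" for j using assms(3)[of j] by simp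
  have F: "padic_fourier \<mu> (padic_atom b t \<gamma>) \<xi> = q * padic_char (- b) t * padic_atom (- t) b (- \<gamma>) \<xi>" for b t \<xi>
    unfolding padic_fourier_atom[OF assms(2)] q_def ..
  \<comment> \<open>Quantified over centre and frequency afresh: it is used for (t, -b) and for (-t,
    b).\<close>
  have F': "padic_fourier \<mu> (padic_atom b t (- \<gamma>)) \<xi> = inverse q * padic_char (- b) t * padic_atom (- t) b \<gamma> \<xi>" for b t \<xi>
    unfolding padic_fourier_atom[OF assms(2)] q' minus_minus ..

  \<comment> \<open>Membership in the Lizorkin space\<close>
  show "padic_wavelet \<gamma> s a \<in> padic_Lizorkin \<mu>"
    unfolding padic_Lizorkin_def
  \<comment> \<open>By \<open>F'\<close>, the atom with centre t and frequency -b transforms into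
    the required one; the scalar cancels the volume factor and the phase.\<close>
  proof (rule image_eqI[of _ _ "\<lambda>\<xi>. K * q * padic_char (- b) t * padic_atom t (- b) (- \<gamma>) \<xi>"])
    show "padic_wavelet \<gamma> s a = padic_fourier \<mu> (\<lambda>\<xi>. K * q * padic_char (- b) t * padic_atom t (- b) (- \<gamma>) \<xi>)"
    proof
      fix x
      have "padic_char (- b) t * padic_char (- t) (- b) = 1"
        using padic_char_mult_minus[of t b] by (simp add: padic_char_minus_swap padic_char_commute[of t] mult.commute)
      then have "K * padic_atom b t \<gamma> x
          = K * (q * inverse q) * (padic_char (- b) t * padic_char (- t) (- b)) * padic_atom b t \<gamma> x"
        using q0 by simp
      also have "\<dots> = K * q * padic_char (- b) t * (inverse q * padic_char (- t) (- b) * padic_atom b t \<gamma> x)"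
        by (simp only: mult_ac)
      finally show "padic_wavelet \<gamma> s a x = padic_fourier \<mu> (\<lambda>\<xi>. K * q * padic_char (- b) t * padic_atom t (- b) (- \<gamma>) \<xi>) x"
        by (simp only: padic_fourier_cmult F' W minus_minus)
    qed
    \<comment> \<open>This keeps 0 out of the support of the preimage, which therefore vanishes
      there.\<close>
    have "t \<notin> padic_box (- \<gamma>)"
    proof
      assume "t \<in> padic_box (- \<gamma>)"
      then have "real CARD('p) powi (int (m j) - \<gamma>) \<le> real CARD('p) powi (- \<gamma>)" for j
        by (simp only: padic_box_def mem_Collect_eq t)
      then show False using lt by (simp only: prime_card_powi_le_iff) (simp add: not_less[symmetric])
    qed
    then have "padic_atom t (- b) (- \<gamma>) 0 = 0" by (simp add: padic_atom_def)
    then show "(\<lambda>\<xi>. K * q * padic_char (- b) t * padic_atom t (- b) (- \<gamma>) \<xi>) \<in> {\<psi> \<in> padic_test_functions. \<psi> 0 = 0}"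
      using padic_atom_test_function by simp
  qed

  \<comment> \<open>Nonvanishing\<close>
  have "K \<noteq> 0" by (simp add: K_def)
  \<comment> \<open>At its centre \<open>b\<close> the atom equals 1.\<close>
  then have "padic_wavelet \<gamma> s a b \<noteq> 0" by (simp add: W padic_atom_def)
  then show "padic_wavelet \<gamma> s a \<noteq> (\<lambda>x. 0)" by auto

  \<comment> \<open>The eigenvalue equation\<close>
  define c where "c = of_nat CARD('p) powr (\<beta> * of_int (int (Max (range m)) - \<gamma>))"
  have "Max (range (\<lambda>j. int (m j) - \<gamma>)) = int (Max (range m)) - \<gamma>"
  proof (rule Max_eqI)
    have "Max (range m) \<in> range m" by (rule Max_in) auto
    then obtain j where "Max (range m) = m j" by blast
    then show "int (Max (range m)) - \<gamma> \<in> range (\<lambda>j. int (m j) - \<gamma>)"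
      by (intro image_eqI[of _ _ j]) simp_all
  qed auto
  \<comment> \<open>On the support of the atom the norm is constant by
    \<open>padic_vec_abs_shell\<close>; elsewhere both sides are 0.\<close>
  then have mult: "of_real (padic_vec_abs \<xi>) powr \<beta> * padic_atom (- t) b (- \<gamma>) \<xi> = c * padic_atom (- t) b (- \<gamma>) \<xi>" for \<xi>
  proof (cases "\<xi> + t \<in> padic_box (- \<gamma>)")
    case True
    then have "padic_vec_abs \<xi> = real CARD('p) powi (int (Max (range m)) - \<gamma>)"
      using padic_vec_abs_shell[OF t lt True] \<open>Max (range (\<lambda>j. int (m j) - \<gamma>)) = _\<close> by simp
    then show ?thesis by (simp only: of_real_powi_powr[OF zero_less_card_finite] c_def)
  qed (simp add: padic_atom_def)
  fix x
  \<comment> \<open>The inverse transform at x is the forward transform at -x, so the formula for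
    atoms applies a second time.\<close>
  have "Taibleson_op \<mu> \<beta> (padic_wavelet \<gamma> s a) x
      = padic_fourier \<mu> (\<lambda>\<xi>. of_real (padic_vec_abs \<xi>) powr \<beta> * (K * (q * padic_char (- b) t * padic_atom (- t) b (- \<gamma>) \<xi>))) (- x)"
    unfolding Taibleson_op_def padic_inv_fourier_def padic_fourier_def[of _ _ "- x"] W padic_fourier_cmult F ..
  also have "(\<lambda>\<xi>. of_real (padic_vec_abs \<xi>) powr \<beta> * (K * (q * padic_char (- b) t * padic_atom (- t) b (- \<gamma>) \<xi>)))
      = (\<lambda>\<xi>. c * K * q * padic_char (- b) t * padic_atom (- t) b (- \<gamma>) \<xi>)"
    using mult by (simp add: fun_eq_iff mult_ac)
  also have "padic_fourier \<mu> \<dots> (- x) = c * K * (padic_char (- b) t * padic_char t b) * padic_atom (- b) (- t) \<gamma> (- x)"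
  proof -
    have "padic_fourier \<mu> (\<lambda>\<xi>. c * K * q * padic_char (- b) t * padic_atom (- t) b (- \<gamma>) \<xi>) (- x)
        = c * K * q * padic_char (- b) t * (inverse q * padic_char t b * padic_atom (- b) (- t) \<gamma> (- x))"
      by (simp only: padic_fourier_cmult F' minus_minus)
    also have "\<dots> = c * K * (q * inverse q) * (padic_char (- b) t * padic_char t b) * padic_atom (- b) (- t) \<gamma> (- x)"
      by (simp only: mult_ac)
    finally show ?thesis using q0 by simp
  qed
  \<comment> \<open>The phases of the two transforms cancel, as the volume factors did.\<close>
  also have "padic_char (- b) t * padic_char t b = 1"
    using padic_char_mult_minus[of b t] by (simp add: padic_char_commute[of t] mult.commute)
  \<comment> \<open>Two transforms reflect centre and frequency; evaluation at -x undoes both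
    reflections.\<close>
  also have "padic_atom (- b) (- t) \<gamma> (- x) = padic_atom b t \<gamma> x"
    using padic_box_diff_commute[of b x \<gamma>] by (simp add: padic_atom_def padic_char_minus_swap indicator_def)
  finally show "Taibleson_op \<mu> \<beta> (padic_wavelet \<gamma> s a) x
      = of_nat CARD('p) powr (\<beta> * of_int (int (Max (range m)) - \<gamma>)) * padic_wavelet \<gamma> s a x"
    by (simp add: W c_def)
qed

end
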